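(* Let $n,d\ge1$, let $C\in\mathbb{R}^{nd\times nd}$ be symmetric, let $\bar f:\mathcal{O}(d)^n\to\mathbb{R}$, $\bar f(G)=\operatorname{tr}(G^\top CG)$, and let $f:\mathcal{Q}\to\mathbb{R}$, $f([G])=\bar f(G)$, be the induced function on the quotient manifold $\mathcal{Q}=\mathcal{O}(d)^n/\mathcal{O}(d)$. For every $[G]\in\mathcal{Q}$ and every $\bar G\in\pi^{-1}([G])$, the unique horizontal lift at $\bar G$ of the Riemannian gradient $\operatorname{grad} f([G])$ is $$\overline{\operatorname{grad} f([G])}_{\bar G}=\operatorname{grad}\bar f(\bar G)=-2S(\bar G)\bar G,$$ where $S(X):=\operatorname{symblockdiag}(CXX^\top)-C\in\mathbb{R}^{nd\times nd}$ for $X\in\mathbb{R}^{nd\times d}$.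
   Context: Matrices in $\mathbb{R}^{nd\times d}$ are written $X=[X_1;\dots;X_n]$ with $d\times d$ blocks; $nd\times nd$ matrices have $d\times d$ blocks $M_{ij}$. $\mathcal{O}(d)^n$ is the set of $X$ with all $X_i$ orthogonal, a Riemannian submanifold of $\mathbb{R}^{nd\times d}$ with the metric $\langle X,Y\rangle=\operatorname{tr}(X^\top Y)$. $\operatorname{symblockdiag}:\mathbb{R}^{nd\times nd}\to\mathbb{R}^{nd\times nd}$ is the linear map with $\operatorname{symblockdiag}(M)_{ii}=\frac{M_{ii}+M_{ii}^\top}{2}$ and $\operatorname{symblockdiag}(M)_{ij}=0$ for $i\ne j$. $\mathcal{O}(d)$ acts on $\mathcal{O}(d)^n$ by $(G,Q)\mapsto GQ$; $\pi:\mathcal{O}(d)^n\to\mathcal{Q}$, $\pi(G)=[G]=\{GQ:Q\in\mathcal{O}(d)\}$. The vertical space at $\bar G$ is $\operatorname{T}_{\bar G}(\pi^{-1}([G]))$ and the horizontal space $\mathcal{H}_{\bar G}$ is its orthogonal complement in $\operatorname{T}_{\bar G}\mathcal{O}(d)^n$. The horizontal lift at $\bar G$ of $\xi\in\operatorname{T}_{[G]}\mathcal{Q}$ is the unique $\bar\xi_{\bar G}\in\mathcal{H}_{\bar G}$ with $\operatorname{D}\pi(\bar G)[\bar\xi_{\bar G}]=\xi$. $\mathcal{Q}$ carries the Riemannian metric given by the Frobenius inner product of horizontal lifts. $\operatorname{grad}$ denotes the Riemannian gradient on the respective manifold. *)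

theory Defs
  imports "HOL-Analysis.Analysis"
begin

section \<open>Block matrices\<close>

text \<open>
  The row index set of an \<open>nd \<times> d\<close> matrix is \<^typ>\<open>'n \<times> 'd\<close>: the pair \<open>(i, a)\<close> is row \<open>a\<close> of
  block \<open>i\<close>. Here \<open>n\<close> and \<open>d\<close> are the cardinalities of the (nonempty) finite types \<open>'n\<close> and \<open>'d\<close>.
\<close>

type_synonym ('n, 'd) stacked = "real^'d^('n \<times> 'd)"
type_synonym ('n, 'd) blockmat = "real^('n \<times> 'd)^('n \<times> 'd)"

definition row_block :: "('n::finite, 'd::finite) stacked \<Rightarrow> 'n \<Rightarrow> real^'d^'d"
  where "row_block X i = (\<chi> a b. X $ (i, a) $ b)"

definition block :: "('n::finite, 'd::finite) blockmat \<Rightarrow> 'n \<Rightarrow> 'n \<Rightarrow> real^'d^'d"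
  where "block M i j = (\<chi> a b. M $ (i, a) $ (j, b))"

definition symblockdiag :: "('n::finite, 'd::finite) blockmat \<Rightarrow> ('n, 'd) blockmat"
  where "symblockdiag M = (\<chi> p q. if fst p = fst q
     then ((1 / 2) *\<^sub>R (block M (fst p) (fst p) + transpose (block M (fst p) (fst p)))) $ snd p $ snd q
     else 0)"

definition S_mat :: "('n::finite, 'd::finite) blockmat \<Rightarrow> ('n, 'd) stacked \<Rightarrow> ('n, 'd) blockmat"
  where "S_mat C X = symblockdiag (C ** X ** transpose X) - C"

definition cost :: "('n::finite, 'd::finite) blockmat \<Rightarrow> ('n, 'd) stacked \<Rightarrow> real"
  where "cost C G = trace (transpose G ** C ** G)"

definition frob :: "('n::finite, 'd::finite) stacked \<Rightarrow> ('n, 'd) stacked \<Rightarrow> real"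
  where "frob X Y = trace (transpose X ** Y)"

definition orth_pow :: "('n::finite, 'd::finite) stacked set"
  where "orth_pow = {X. \<forall>i. orthogonal_matrix (row_block X i)}"


section \<open>Embedded submanifolds\<close>

text \<open>\<open>C\<^sup>k\<close> and \<open>C\<^sup>\<infinity>\<close> maps on an \<^emph>\<open>open\<close> subset \<open>U\<close> of a finite-dimensional space.\<close>

primrec Ck_on :: "nat \<Rightarrow> 'a::real_normed_vector set \<Rightarrow> ('a \<Rightarrow> 'b::real_normed_vector) \<Rightarrow> bool"
  where
    "Ck_on 0 U f \<longleftrightarrow> continuous_on U f"
  | "Ck_on (Suc k) U f \<longleftrightarrow> (\<forall>x\<in>U. f differentiable (at x)) \<and>
       (\<forall>v. Ck_on k U (\<lambda>x. frechet_derivative f (at x) v))"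

definition smooth_on :: "'a::real_normed_vector set \<Rightarrow> ('a \<Rightarrow> 'b::real_normed_vector) \<Rightarrow> bool"
  where "smooth_on U f \<longleftrightarrow> (\<forall>k. Ck_on k U f)"

text \<open>
  In this section \<open>M\<close> is meant to be an embedded submanifold of a Euclidean space: tangent vectors
  are the velocities of smooth curves in \<open>M\<close>, and functions on \<open>M\<close> are smooth if they locally
  extend to smooth functions on the ambient space.
\<close>

definition curve_in :: "'a::euclidean_space set \<Rightarrow> 'a \<Rightarrow> 'a \<Rightarrow> (real \<Rightarrow> 'a) \<Rightarrow> bool"
  where "curve_in M x v \<gamma> \<longleftrightarrow>
     (\<exists>e>0. smooth_on {-e<..<e} \<gamma> \<and> \<gamma> ` {-e<..<e} \<subseteq> M) \<and>
     \<gamma> 0 = x \<and> (\<gamma> has_vector_derivative v) (at 0)"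

definition tangent_space :: "'a::euclidean_space set \<Rightarrow> 'a \<Rightarrow> 'a set"
  where "tangent_space M x = {v. \<exists>\<gamma>. curve_in M x v \<gamma>}"

definition smooth_fun :: "'a::euclidean_space set \<Rightarrow> ('a \<Rightarrow> real) \<Rightarrow> bool"
  where "smooth_fun M F \<longleftrightarrow>
     (\<forall>x\<in>M. \<exists>U F'. open U \<and> x \<in> U \<and> smooth_on U F' \<and> (\<forall>y\<in>U \<inter> M. F' y = F y))"

text \<open>
  The differential \<open>D F(x)[v]\<close> of a function on \<open>M\<close>, for \<open>v\<close> tangent to \<open>M\<close> at \<open>x\<close>: the common
  derivative of \<open>F\<close> along all smooth curves in \<open>M\<close> through \<open>x\<close> with velocity \<open>v\<close>. Only the values
  of \<open>F\<close> on \<open>M\<close> matter.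
\<close>

definition differential :: "'a::euclidean_space set \<Rightarrow> ('a \<Rightarrow> real) \<Rightarrow> 'a \<Rightarrow> 'a \<Rightarrow> real"
  where "differential M F x v =
     (THE r. \<forall>\<gamma>. curve_in M x v \<gamma> \<longrightarrow> ((\<lambda>t. F (\<gamma> t)) has_real_derivative r) (at 0))"

definition grad :: "(('n::finite, 'd::finite) stacked \<Rightarrow> real) \<Rightarrow> ('n, 'd) stacked \<Rightarrow> ('n, 'd) stacked"
  where "grad F G = (THE g. g \<in> tangent_space orth_pow G \<and>
     (\<forall>v \<in> tangent_space orth_pow G. frob g v = differential orth_pow F G v))"


section \<open>The quotient manifold\<close>

type_synonym ('n, 'd) cls = "('n, 'd) stacked set"

definition proj :: "('n::finite, 'd::finite) stacked \<Rightarrow> ('n, 'd) cls"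
  where "proj G = {G ** Q | Q. orthogonal_matrix Q}"

definition quot :: "('n::finite, 'd::finite) cls set"
  where "quot = proj ` orth_pow"

text \<open>
  The value at a class \<open>p\<close> of the function induced by an invariant \<open>F\<close>, i.e. the common value of \<open>F\<close>
  on the representatives of \<open>p\<close>.
\<close>

definition induced :: "(('n::finite, 'd::finite) stacked \<Rightarrow> 'b) \<Rightarrow> ('n, 'd) cls \<Rightarrow> 'b"
  where "induced F p = (THE r. \<forall>G\<in>p. F G = r)"

text \<open>
  The smooth structure of the quotient is the one that makes \<^const>\<open>proj\<close> a submersion; its smooth
  functions are those with smooth pullback along \<^const>\<open>proj\<close>. A curve in the quotient is smooth iff
  all smooth functions are smooth along it.

  A tangent vector at \<open>p\<close> is the operator sending a smooth function to its derivative along a smooth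
  curve through \<open>p\<close>. Global smooth functions suffice for this, by means of bump functions.
\<close>

definition quot_smooth :: "(('n::finite, 'd::finite) cls \<Rightarrow> real) set"
  where "quot_smooth = {h. smooth_fun orth_pow (\<lambda>G. h (proj G))}"

definition quot_curve :: "('n::finite, 'd::finite) cls \<Rightarrow> (real \<Rightarrow> ('n, 'd) cls) \<Rightarrow> bool"
  where "quot_curve p c \<longleftrightarrow>
     (\<exists>e>0. c ` {-e<..<e} \<subseteq> quot \<and> (\<forall>h \<in> quot_smooth. smooth_on {-e<..<e} (\<lambda>t. h (c t)))) \<and>
     c 0 = p"

type_synonym ('n, 'd) qvec = "(('n, 'd) cls \<Rightarrow> real) \<Rightarrow> real"

definition quot_tangent_space :: "('n::finite, 'd::finite) cls \<Rightarrow> ('n, 'd) qvec set"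
  where "quot_tangent_space p =
     {(\<lambda>h \<in> quot_smooth. deriv (\<lambda>t. h (c t)) 0) | c. quot_curve p c}"

text \<open>\<open>D \<pi>(G)[v]\<close>, for \<open>v\<close> tangent to \<^const>\<open>orth_pow\<close> at \<open>G\<close>.\<close>

definition dproj :: "('n::finite, 'd::finite) stacked \<Rightarrow> ('n, 'd) stacked \<Rightarrow> ('n, 'd) qvec"
  where "dproj G v = (\<lambda>h \<in> quot_smooth. differential orth_pow (\<lambda>X. h (proj X)) G v)"

definition vertical_space :: "('n::finite, 'd::finite) stacked \<Rightarrow> ('n, 'd) stacked set"
  where "vertical_space G = tangent_space {X \<in> orth_pow. proj X = proj G} G"

definition horizontal_space :: "('n::finite, 'd::finite) stacked \<Rightarrow> ('n, 'd) stacked set"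
  where "horizontal_space G =
     {v \<in> tangent_space orth_pow G. \<forall>w \<in> vertical_space G. frob v w = 0}"

definition is_horizontal_lift ::
    "('n::finite, 'd::finite) stacked \<Rightarrow> ('n, 'd) qvec \<Rightarrow> ('n, 'd) stacked \<Rightarrow> bool"
  where "is_horizontal_lift G \<xi> v \<longleftrightarrow> v \<in> horizontal_space G \<and> dproj G v = \<xi>"

definition horizontal_lift ::
    "('n::finite, 'd::finite) stacked \<Rightarrow> ('n, 'd) qvec \<Rightarrow> ('n, 'd) stacked"
  where "horizontal_lift G \<xi> = (THE v. is_horizontal_lift G \<xi> v)"

definition quot_metric ::
    "('n::finite, 'd::finite) cls \<Rightarrow> ('n, 'd) qvec \<Rightarrow> ('n, 'd) qvec \<Rightarrow> real"
  where "quot_metric p \<xi> \<eta> = induced (\<lambda>G. frob (horizontal_lift G \<xi>) (horizontal_lift G \<eta>)) p"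

text \<open>For smooth \<open>f\<close> the differential \<open>D f(p)[\<eta>]\<close> is \<open>\<eta> f\<close>.\<close>

definition quot_grad ::
    "(('n::finite, 'd::finite) cls \<Rightarrow> real) \<Rightarrow> ('n, 'd) cls \<Rightarrow> ('n, 'd) qvec"
  where "quot_grad f p = (THE \<xi>. \<xi> \<in> quot_tangent_space p \<and>
     (\<forall>\<eta> \<in> quot_tangent_space p. quot_metric p \<xi> \<eta> = \<eta> f))"

end

theory Submission
  imports Defs
begin

text \<open>
  Differentiating the constraints shows that the tangent vectors at \<open>G\<close> are the \<open>v\<close> with all
  \<open>v\<^sub>i G\<^sub>i\<^sup>T\<close> skew; conversely, Cayley transforms provide smooth curves with these velocities.
  Tangency of \<open>-2SG\<close> is then a computation, and it represents the differential of the cost because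
  the symmetric block diagonal part is orthogonal to all tangent vectors.

  For the quotient, the class of \<open>X\<close> has the normal form \<open>X X\<^sub>i\<^sup>T G\<^sub>i\<close>. Its entries are smooth
  functions on the quotient, so every smooth curve through the class of \<open>G\<close> lifts to a smooth curve
  through \<open>G\<close>. Multiplying the lift by a suitable curve in the orthogonal group makes its velocity \<open>v\<close>
  horizontal (\<open>G\<^sup>T v = 0\<close>). Differentiating the normal form also shows that tangent vectors
  with the same image in the quotient differ by a vertical vector \<open>G W\<close>, \<open>W\<close> skew. Finally, the gradient
  upstairs is horizontal because the cost is constant on fibres, so it represents the differential
  of the induced function.
\<close>

section \<open>Smooth maps\<close>

text \<open>Derivatives at points of an open set depend only on nearby values, so the equality of
  \<open>f\<close> and \<open>g\<close> passes to their \<open>frechet_derivative\<close>s and the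
  induction goes through.\<close>

lemma Ck_on_cong:
  assumes "open U" "\<And>x. x \<in> U \<Longrightarrow> f x = g x" "Ck_on k U f"
  shows "Ck_on k U g"
  using assms(2,3)
proof (induction k arbitrary: f g)
  case 0
  then show ?case by (simp cong: continuous_on_cong)
next
  case (Suc k)
  have d: "f differentiable at x" if "x \<in> U" for x using Suc.prems that by simp
  have "g differentiable at x" if "x \<in> U" for x
    using has_derivative_transform_within_open[of f _ x UNIV U g] d[OF that] \<open>open U\<close> that Suc.prems(1)
    unfolding differentiable_def by blast
  moreover have "Ck_on k U (\<lambda>x. frechet_derivative g (at x) v)" for v
  proof (rule Suc.IH)
    show "Ck_on k U (\<lambda>x. frechet_derivative f (at x) v)" using Suc.prems by simp
    show "frechet_derivative f (at x) v = frechet_derivative g (at x) v" if "x \<in> U" for x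
      using frechet_derivative_transform_within_open[OF d[OF that] \<open>open U\<close> that Suc.prems(1)]
      by simp
  qed
  ultimately show ?case by simp
qed

text \<open>Lets any explicitly known derivative \<open>D\<close> stand in for the chosen
  \<open>frechet_derivative\<close>; the closure properties below all raise the order of
  differentiability through it.\<close>

lemma Ck_on_SucI:
  assumes U: "open U" and D: "\<And>x. x \<in> U \<Longrightarrow> (f has_derivative D x) (at x)"
    and "\<And>v. Ck_on k U (\<lambda>x. D x v)"
  shows "Ck_on (Suc k) U f"
proof -
  have "Ck_on k U (\<lambda>x. frechet_derivative f (at x) v)" for v
    by (rule Ck_on_cong[OF U _ assms(3)[of v]]) (simp add: frechet_derivative_at[OF D, symmetric])
  then show ?thesis using D by (auto simp: differentiable_def)
qed

lemma Ck_on_SucD_has_derivative: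
  "Ck_on (Suc k) U f \<Longrightarrow> x \<in> U \<Longrightarrow> (f has_derivative frechet_derivative f (at x)) (at x)"
  by (simp flip: frechet_derivative_works)

lemma Ck_on_SucD: "Ck_on (Suc k) U f \<Longrightarrow> Ck_on k U f"
proof (induction k arbitrary: f)
  case 0
  then show ?case
    by (auto intro!: continuous_at_imp_continuous_on differentiable_imp_continuous_within)
next
  case (Suc k)
  then show ?case by (metis Ck_on.simps(2))
qed

lemma Ck_on_subset: "Ck_on k U f \<Longrightarrow> V \<subseteq> U \<Longrightarrow> Ck_on k V f"
  by (induction k arbitrary: f) (auto intro: continuous_on_subset)

text \<open>Continuity and differentiability are pointwise conditions here, so they can be checked
  on neighbourhoods. This is what functions with merely local smooth extensions require.\<close>

lemma Ck_on_local:
  assumes "\<And>x. x \<in> U \<Longrightarrow> \<exists>W. open W \<and> x \<in> W \<and> Ck_on k W f"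
  shows "Ck_on k U f"
  using assms
proof (induction k arbitrary: f)
  case 0
  then have "isCont f x" if "x \<in> U" for x
    using that by (metis Ck_on.simps(1) continuous_on_eq_continuous_at)
  then show ?case by (simp add: continuous_at_imp_continuous_on)
next
  case (Suc k)
  have "f differentiable at x" if "x \<in> U" for x using Suc.prems[OF that] by auto
  moreover have "Ck_on k U (\<lambda>x. frechet_derivative f (at x) v)" for v
    by (rule Suc.IH) (metis Ck_on.simps(2) Suc.prems)
  ultimately show ?case by simp
qed

lemma Ck_on_const: "open U \<Longrightarrow> Ck_on k U (\<lambda>x. c)"
  by (induction k arbitrary: c) (auto intro: Ck_on_SucI derivative_intros)

lemma Ck_on_ident: "open U \<Longrightarrow> Ck_on k U (\<lambda>x. x)"
  by (cases k) (auto intro: Ck_on_SucI[where D = "\<lambda>x v. v"] Ck_on_const simp del: Ck_on.simps(2))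

lemma Ck_on_bounded_linear:
  assumes "open U" "bounded_linear L" "Ck_on k U f"
  shows "Ck_on k U (\<lambda>x. L (f x))"
  using assms(3)
proof (induction k arbitrary: f)
  case 0
  then show ?case using bounded_linear.continuous_on[OF assms(2)] by simp
next
  case (Suc k)
  show ?case
    by (rule Ck_on_SucI[OF \<open>open U\<close>
          bounded_linear.has_derivative[OF assms(2) Ck_on_SucD_has_derivative[OF Suc.prems]]])
       (use Suc in auto)
qed

lemma Ck_on_add:
  assumes "open U" "Ck_on k U f" "Ck_on k U g"
  shows "Ck_on k U (\<lambda>x. f x + g x)"
  using assms(2,3)
proof (induction k arbitrary: f g)
  case 0
  then show ?case by (simp add: continuous_on_add)
next
  case (Suc k)
  show ?case
    by (rule Ck_on_SucI[OF \<open>open U\<close> has_derivative_add[OF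
          Ck_on_SucD_has_derivative[OF Suc.prems(1)] Ck_on_SucD_has_derivative[OF Suc.prems(2)]]])
       (use Suc in auto)
qed

lemma Ck_on_sum:
  assumes "open U" "\<And>i. i \<in> I \<Longrightarrow> Ck_on k U (f i)"
  shows "Ck_on k U (\<lambda>x. \<Sum>i\<in>I. f i x)"
  using assms by (induction I rule: infinite_finite_induct) (auto intro: Ck_on_const Ck_on_add)

lemma Ck_on_bilinear:
  assumes "bounded_bilinear h" "open U" "Ck_on k U f" "Ck_on k U g"
  shows "Ck_on k U (\<lambda>x. h (f x) (g x))"
  using assms(3,4)
proof (induction k arbitrary: f g)
  case 0
  then show ?case by (simp add: bounded_bilinear.continuous_on[OF assms(1)])
next
  case (Suc k)
  show ?case
  proof (rule Ck_on_SucI[OF \<open>open U\<close> bounded_bilinear.FDERIV[OF assms(1)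
        Ck_on_SucD_has_derivative[OF Suc.prems(1)] Ck_on_SucD_has_derivative[OF Suc.prems(2)]]])
    show "Ck_on k U (\<lambda>x. h (f x) (frechet_derivative g (at x) v)
        + h (frechet_derivative f (at x) v) (g x))" for v
      using Suc.prems Ck_on_SucD[OF Suc.prems(1)] Ck_on_SucD[OF Suc.prems(2)]
      by (intro Ck_on_add Suc.IH \<open>open U\<close>) auto
  qed auto
qed

text \<open>The chain rule evaluates \<open>frechet_derivative g\<close> at a direction that itself
  varies with \<open>x\<close>, whereas \<open>Ck_on\<close> speaks of fixed directions only.
  Expanding the direction in the finite basis of the middle space leaves sums of products, to which
  the induction applies.\<close>

lemma Ck_on_compose:
  fixes f :: "'a::real_normed_vector \<Rightarrow> 'b::euclidean_space"
  assumes "open U" "open V" "f ` U \<subseteq> V" "Ck_on k U f" "Ck_on k V g"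
  shows "Ck_on k U (\<lambda>x. g (f x))"
  using assms(4,5)
proof (induction k arbitrary: g)
  case 0
  then show ?case using assms(3) by (auto intro: continuous_on_compose2)
next
  case (Suc k)
  let ?D = "\<lambda>x v. \<Sum>b\<in>Basis. (frechet_derivative f (at x) v \<bullet> b) *\<^sub>R frechet_derivative g (at (f x)) b"
  show ?case
  proof (rule Ck_on_SucI[where D = ?D, OF \<open>open U\<close>])
    fix x assume x: "x \<in> U"
    then have fx: "f x \<in> V" using assms(3) by auto
    note dg = Ck_on_SucD_has_derivative[OF Suc.prems(2) fx]
    have "((\<lambda>x. g (f x)) has_derivative (\<lambda>v. frechet_derivative g (at (f x)) (frechet_derivative f (at x) v))) (at x)"
      using has_derivative_compose[OF Ck_on_SucD_has_derivative[OF Suc.prems(1) x] dg] .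
    moreover have "frechet_derivative g (at (f x)) (frechet_derivative f (at x) v) = ?D x v" for v
    proof -
      have lin: "linear (frechet_derivative g (at (f x)))"
        using dg has_derivative_linear by blast
      from linear_sum[OF lin, of "\<lambda>b. (frechet_derivative f (at x) v \<bullet> b) *\<^sub>R b" Basis]
      show ?thesis
        by (simp add: linear_cmul[OF lin] euclidean_representation)
    qed
    then have "(\<lambda>v. frechet_derivative g (at (f x)) (frechet_derivative f (at x) v)) = ?D x"
      by (rule ext)
    ultimately show "((\<lambda>x. g (f x)) has_derivative ?D x) (at x)" by (simp only:)
  next
    fix v
    have "Ck_on k U f" "\<And>v. Ck_on k U (\<lambda>x. frechet_derivative f (at x) v)"
      using Ck_on_SucD[OF Suc.prems(1)] Suc.prems by auto
    moreover have "Ck_on k U (\<lambda>x. frechet_derivative g (at (f x)) b)" for b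
      by (rule Suc.IH[OF \<open>Ck_on k U f\<close>]) (use Suc.prems in auto)
    ultimately show "Ck_on k U (\<lambda>x. ?D x v)"
      by (intro Ck_on_sum Ck_on_bilinear[OF bounded_bilinear_scaleR]
          Ck_on_bounded_linear[OF _ bounded_linear_inner_left] \<open>open U\<close>)
  qed
qed

section \<open>Closure properties of smooth maps\<close>

lemma smooth_on_subset: "smooth_on U f \<Longrightarrow> V \<subseteq> U \<Longrightarrow> smooth_on V f"
  unfolding smooth_on_def using Ck_on_subset by blast

lemma smooth_on_const: "open U \<Longrightarrow> smooth_on U (\<lambda>x. c)"
  unfolding smooth_on_def using Ck_on_const by blast

lemma smooth_on_ident: "open U \<Longrightarrow> smooth_on U (\<lambda>x. x)"
  unfolding smooth_on_def using Ck_on_ident by blast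

lemma smooth_on_bounded_linear:
  "open U \<Longrightarrow> bounded_linear L \<Longrightarrow> smooth_on U f \<Longrightarrow> smooth_on U (\<lambda>x. L (f x))"
  unfolding smooth_on_def using Ck_on_bounded_linear by blast

lemma smooth_on_bilinear:
  "bounded_bilinear h \<Longrightarrow> open U \<Longrightarrow> smooth_on U f \<Longrightarrow> smooth_on U g
    \<Longrightarrow> smooth_on U (\<lambda>x. h (f x) (g x))"
  unfolding smooth_on_def using Ck_on_bilinear by blast

lemma smooth_on_componentwise:
  fixes f :: "'a::real_normed_vector \<Rightarrow> 'b::euclidean_space"
  assumes "open U" "\<And>b. b \<in> Basis \<Longrightarrow> smooth_on U (\<lambda>x. f x \<bullet> b)"
  shows "smooth_on U f"
proof -
  have "smooth_on U (\<lambda>x. \<Sum>b\<in>Basis. (f x \<bullet> b) *\<^sub>R b)"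
    using assms unfolding smooth_on_def
    by (auto intro!: Ck_on_sum Ck_on_bounded_linear[OF _ bounded_linear_scaleR_left])
  then show ?thesis by (simp add: euclidean_representation)
qed

lemma smooth_on_differentiable: "smooth_on U f \<Longrightarrow> x \<in> U \<Longrightarrow> f differentiable at x"
  unfolding smooth_on_def by (metis Ck_on.simps(2))

lemma smooth_on_continuous: "smooth_on U f \<Longrightarrow> continuous_on U f"
  unfolding smooth_on_def by (metis Ck_on.simps(1))

text \<open>The local extension of \<open>F\<close> changes from point to point, so smoothness is
  proved near each parameter by composing with the extension valid there.\<close>

lemma smooth_fun_smooth_curve:
  fixes \<gamma> :: "real \<Rightarrow> 'a::euclidean_space"
  assumes F: "smooth_fun M F" and J: "open J" and \<gamma>: "smooth_on J \<gamma>" "\<gamma> ` J \<subseteq> M"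
  shows "smooth_on J (\<lambda>t. F (\<gamma> t))"
  unfolding smooth_on_def
proof (intro allI Ck_on_local)
  fix k x assume "x \<in> J"
  then have "\<gamma> x \<in> M" using \<gamma> by auto
  then obtain U F' where U: "open U" "\<gamma> x \<in> U" "smooth_on U F'" "\<forall>y\<in>U \<inter> M. F' y = F y"
    using F unfolding smooth_fun_def by meson
  let ?W = "J \<inter> \<gamma> -` U"
  have W: "open ?W"
    using continuous_open_preimage[OF smooth_on_continuous[OF \<gamma>(1)] J U(1)] .
  have "Ck_on k ?W (\<lambda>t. F' (\<gamma> t))"
  proof (rule Ck_on_compose[OF W U(1)])
    show "Ck_on k ?W \<gamma>" using Ck_on_subset[of k J \<gamma> ?W] \<gamma>(1) by (simp add: smooth_on_def)
    show "Ck_on k U F'" using U(3) by (simp add: smooth_on_def)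
  qed auto
  then have "Ck_on k ?W (\<lambda>t. F (\<gamma> t))"
    by (rule Ck_on_cong[OF W, rotated]) (use U(4) \<gamma>(2) in auto)
  then show "\<exists>W. open W \<and> x \<in> W \<and> Ck_on k W (\<lambda>t. F (\<gamma> t))"
    using W U(2) \<open>x \<in> J\<close> by blast
qed

section \<open>Derivatives along curves in a submanifold\<close>

lemma curve_in_eventually:
  assumes "curve_in M x v \<gamma>" shows "\<forall>\<^sub>F t in nhds 0. \<gamma> t \<in> M"
proof -
  obtain e where "e > 0" "\<gamma> ` {-e<..<e} \<subseteq> M" using assms unfolding curve_in_def by auto
  then show ?thesis
    by (intro eventually_nhds_in_open[of "{-e<..<e}" 0, THEN eventually_mono]) auto
qed

lemma has_vector_derivative_eventually_eq:
  assumes "(f has_vector_derivative D) (at x)" "\<forall>\<^sub>F t in nhds x. f t = g t"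
  shows "(g has_vector_derivative D) (at x)"
proof -
  obtain W where "open W" "x \<in> W" "\<And>t. t \<in> W \<Longrightarrow> f t = g t"
    using assms(2) unfolding eventually_nhds by auto
  then show ?thesis using has_vector_derivative_transform_within_open[OF assms(1)] by blast
qed

text \<open>The derivative of a single local extension serves all curves through \<open>x\<close>,
  so the result depends on the velocity alone. This makes \<open>differential\<close> meaningful for
  smooth functions.\<close>

lemma smooth_fun_has_derivative_along_curves:
  assumes "smooth_fun M F" "x \<in> M"
  obtains D where "\<And>v \<gamma>. curve_in M x v \<gamma> \<Longrightarrow> ((\<lambda>t. F (\<gamma> t)) has_real_derivative D v) (at 0)"
proof -
  obtain U F' where U: "open U" "x \<in> U" "smooth_on U F'" "\<forall>y\<in>U \<inter> M. F' y = F y"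
    using assms unfolding smooth_fun_def by meson
  obtain D where D: "(F' has_derivative D) (at x)"
    using smooth_on_differentiable[OF U(3,2)] unfolding differentiable_def by auto
  show ?thesis
  proof (rule that)
    fix v \<gamma> assume c: "curve_in M x v \<gamma>"
    then have g: "\<gamma> 0 = x" "(\<gamma> has_vector_derivative v) (at 0)" unfolding curve_in_def by auto
    have "((\<lambda>t. F' (\<gamma> t)) has_derivative (\<lambda>t. D (t *\<^sub>R v))) (at 0)"
      using has_derivative_compose[OF g(2)[unfolded has_vector_derivative_def]] D g(1) by simp
    then have d: "((\<lambda>t. F' (\<gamma> t)) has_vector_derivative D v) (at 0)"
      using D by (simp add: has_vector_derivative_def linear_cmul has_derivative_linear)
    have "isCont \<gamma> 0" using g(2) has_vector_derivative_continuous by blast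
    then have "\<forall>\<^sub>F t in nhds 0. \<gamma> t \<in> U"
      using U(1,2) g(1) by (simp add: continuous_at_open eventually_nhds)
    with curve_in_eventually[OF c] have "\<forall>\<^sub>F t in nhds 0. F' (\<gamma> t) = F (\<gamma> t)"
      by eventually_elim (use U(4) in auto)
    from has_vector_derivative_eventually_eq[OF d this]
    show "((\<lambda>t. F (\<gamma> t)) has_real_derivative D v) (at 0)"
      by (simp add: has_real_derivative_iff_has_vector_derivative)
  qed
qed

text \<open>The curve in the first premise secures uniqueness: with no curve of velocity
  \<open>v\<close>, every real number would satisfy the defining condition vacuously.\<close>

lemma differential_eqI:
  assumes "curve_in M x v \<gamma>"
    and "\<And>\<gamma>. curve_in M x v \<gamma> \<Longrightarrow> ((\<lambda>t. F (\<gamma> t)) has_real_derivative r) (at 0)"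
  shows "differential M F x v = r"
  unfolding differential_def using assms by (intro the_equality) (auto dest: DERIV_unique)

lemma differential_along_curve:
  assumes "smooth_fun M F" "x \<in> M" "curve_in M x v \<gamma>"
  shows "((\<lambda>t. F (\<gamma> t)) has_real_derivative differential M F x v) (at 0)"
  using smooth_fun_has_derivative_along_curves[OF assms(1,2)] differential_eqI[OF assms(3)] assms(3)
  by metis

section \<open>Matrices and the Cayley transform\<close>

lemma bounded_bilinear_matrix_mult:
  "bounded_bilinear ((**) :: real^'m^'n::finite \<Rightarrow> real^'k::finite^'m::finite \<Rightarrow> real^'k^'n)"
  unfolding bilinear_conv_bounded_bilinear[symmetric] bilinear_def
  by (auto intro!: linearI simp: matrix_matrix_mult_def vec_eq_iff sum.distrib distrib_left
      distrib_right sum_distrib_left mult.assoc mult.left_commute)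

interpretation matrix_mult: bounded_bilinear
  "(**) :: real^'m^'n::finite \<Rightarrow> real^'k::finite^'m::finite \<Rightarrow> real^'k^'n"
  by (rule bounded_bilinear_matrix_mult)

lemma bounded_linear_transpose:
  "bounded_linear (transpose :: real^'m::finite^'n::finite \<Rightarrow> real^'n^'m)"
  by (auto intro!: linearI simp: linear_conv_bounded_linear[symmetric] transpose_def vec_eq_iff)

lemmas transpose_add = linear_add[OF bounded_linear.linear[OF bounded_linear_transpose]]
lemmas transpose_diff = linear_diff[OF bounded_linear.linear[OF bounded_linear_transpose]]

lemma bounded_linear_trace: "bounded_linear (trace :: real^'n::finite^'n \<Rightarrow> real)"
  by (auto intro!: linearI simp: linear_conv_bounded_linear[symmetric] trace_def sum.distrib
      sum_distrib_left)

lemmas trace_minus = linear_neg[OF bounded_linear.linear[OF bounded_linear_trace]]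

lemma trace_transpose: "trace (transpose A) = trace A"
  by (simp add: trace_def transpose_def)

text \<open>Transposing the product preserves its trace, but by the two symmetries and cyclicity it
  also changes the sign.\<close>

lemma trace_symmetric_mult_skew:
  fixes A B :: "real^'n::finite^'n"
  assumes "transpose A = A" "transpose B = - B"
  shows "trace (A ** B) = 0"
proof -
  have "trace (A ** B) = trace (transpose (A ** B))" by (simp add: trace_transpose)
  also have "\<dots> = - trace (A ** B)"
    using assms by (simp add: matrix_transpose_mul matrix_mult.minus_left trace_minus trace_mul_sym[of B])
  finally show ?thesis by simp
qed

text \<open>Caratheodory's form of differentiability: the difference quotient is \<open>g\<close>,
  and its continuity at \<open>s\<close> gives the derivative.\<close>

lemma has_vector_derivative_slopeI:
  assumes "\<And>t. f t - f s = (t - s) *\<^sub>R g t" "(g \<longlongrightarrow> g s) (at s)"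
  shows "(f has_vector_derivative g s) (at s)"
  unfolding has_vector_derivative_def has_derivative_iff_norm
proof
  have "((\<lambda>t. norm (g t - g s)) \<longlongrightarrow> 0) (at s)"
    using assms(2) by (intro tendsto_norm_zero) (simp add: LIM_zero_iff)
  moreover have "\<forall>\<^sub>F t in at s. norm (g t - g s) = norm (f t - f s - (t - s) *\<^sub>R g s) / norm (t - s)"
    by (auto simp: assms(1) eventually_at_filter simp flip: scaleR_diff_right)
  ultimately show "((\<lambda>t. norm (f t - f s - (t - s) *\<^sub>R g s) / norm (t - s)) \<longlongrightarrow> 0) (at s)"
    by (rule Lim_transform_eventually)
qed (rule bounded_linear_scaleR_left)

text \<open>For nonzero \<open>s\<close> this is the usual resolvent at the spectral parameter
  \<open>1/s\<close>, divided by \<open>s\<close>. In this parametrisation \<open>s = 0\<close> is a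
  regular point with the identity as value.\<close>

definition resolvent :: "real^'n::finite^'n \<Rightarrow> real \<Rightarrow> real^'n^'n"
  where "resolvent A s = matrix_inv (mat 1 - s *\<^sub>R A)"

section \<open>Resolvent and Cayley transform of a skew matrix\<close>

context
  fixes A :: "real^'n::finite^'n"
  assumes skew: "transpose A = - A"
begin

text \<open>Skewness gives \<open>x \<bullet> (A *v x) = 0\<close>, so pairing \<open>x\<close> with
  its image under \<open>mat 1 - s *\<^sub>R A\<close> yields the square of \<open>norm x\<close>;
  Cauchy-Schwarz finishes.\<close>

lemma norm_le_skew: "norm x \<le> norm ((mat 1 - s *\<^sub>R A) *v x)"
proof -
  have "x \<bullet> (A *v x) = (x v* A) \<bullet> x" by (simp add: dot_lmul_matrix)
  also have "x v* A = - (A *v x)"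
    unfolding transpose_matrix_vector[symmetric] skew
    by (simp add: matrix_vector_mult_def vec_eq_iff sum_negf)
  also have "- (A *v x) \<bullet> x = - (x \<bullet> (A *v x))" by (simp add: inner_commute)
  finally have "x \<bullet> (A *v x) = 0" by simp
  then have "x \<bullet> ((mat 1 - s *\<^sub>R A) *v x) = x \<bullet> x"
    by (simp add: matrix_vector_mult_diff_rdistrib inner_diff_right flip: scaleR_matrix_vector_assoc)
  then have "(norm x)\<^sup>2 \<le> norm x * norm ((mat 1 - s *\<^sub>R A) *v x)"
    by (metis norm_cauchy_schwarz power2_norm_eq_inner)
  then show ?thesis by (cases "x = 0") (simp_all add: power2_eq_square)
qed

text \<open>By the lower norm bound the kernel is trivial for every real \<open>s\<close>, and an
  injective square matrix is invertible.\<close>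

lemma resolvent_inverse:
  "(mat 1 - s *\<^sub>R A) ** resolvent A s = mat 1" "resolvent A s ** (mat 1 - s *\<^sub>R A) = mat 1"
proof -
  have "x = 0" if "(mat 1 - s *\<^sub>R A) *v x = 0" for x
    using norm_le_skew[of x s] that by simp
  then obtain B where "B ** (mat 1 - s *\<^sub>R A) = mat 1"
    using matrix_left_invertible_ker[of "mat 1 - s *\<^sub>R A"] by auto
  then have "invertible (mat 1 - s *\<^sub>R A)"
    unfolding invertible_def using matrix_left_right_inverse by blast
  then show "(mat 1 - s *\<^sub>R A) ** resolvent A s = mat 1" "resolvent A s ** (mat 1 - s *\<^sub>R A) = mat 1"
    unfolding resolvent_def matrix_inv_def invertible_def by (metis (mono_tags, lifting) someI)+
qed

text \<open>Since \<open>mat 1 - s *\<^sub>R A\<close> never shrinks a vector, the columns of its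
  inverse have norm at most 1. The resulting bound is crude but uniform in \<open>s\<close>, as the
  continuity proof demands.\<close>

lemma norm_resolvent_le: "norm (resolvent A s) \<le> CARD('n) * CARD('n)"
proof -
  have "\<bar>resolvent A s $ i $ j\<bar> \<le> 1" for i j
  proof -
    have "\<bar>resolvent A s $ i $ j\<bar> = \<bar>(resolvent A s *v axis j 1) $ i\<bar>"
      by (simp add: matrix_vector_mult_basis column_def)
    also have "\<dots> \<le> norm (resolvent A s *v axis j 1)" by (rule component_le_norm_cart)
    also have "\<dots> \<le> norm ((mat 1 - s *\<^sub>R A) *v (resolvent A s *v axis j 1))" by (rule norm_le_skew)
    also have "\<dots> = 1" by (simp add: matrix_vector_mul_assoc resolvent_inverse)
    finally show ?thesis .
  qed
  then have row: "norm (resolvent A s $ i) \<le> real CARD('n)" for i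
    using order_trans[OF norm_le_l1_cart[of "resolvent A s $ i"]
        sum_bounded_above[of UNIV "\<lambda>j. \<bar>resolvent A s $ i $ j\<bar>" 1]]
    by simp
  have "norm (resolvent A s) \<le> (\<Sum>i\<in>UNIV. norm (resolvent A s $ i))"
    unfolding norm_vec_def[of "resolvent A s"] by (rule L2_set_le_sum) simp
  also have "\<dots> \<le> real CARD('n) * real CARD('n)"
    using sum_bounded_above[of UNIV "\<lambda>i. norm (resolvent A s $ i)", OF row] by simp
  finally show ?thesis by simp
qed

text \<open>The resolvent identity, obtained by inserting the two matrices that the resolvents
  invert.\<close>

lemma resolvent_diff:
  "resolvent A t - resolvent A s = (t - s) *\<^sub>R (resolvent A t ** A ** resolvent A s)"
proof -
  have "resolvent A t - resolvent A s
      = resolvent A t ** ((mat 1 - s *\<^sub>R A) ** resolvent A s)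
        - (resolvent A t ** (mat 1 - t *\<^sub>R A)) ** resolvent A s"
    by (simp only: resolvent_inverse matrix_mul_lid matrix_mul_rid)
  also have "\<dots> = resolvent A t ** ((mat 1 - s *\<^sub>R A) - (mat 1 - t *\<^sub>R A)) ** resolvent A s"
    by (simp only: matrix_mul_assoc matrix_mult.diff_left matrix_mult.diff_right)
  also have "(mat 1 - s *\<^sub>R A) - (mat 1 - t *\<^sub>R A) = (t - s) *\<^sub>R A" by (simp add: algebra_simps)
  finally show ?thesis by (simp add: matrix_mult.scaleR_left matrix_mult.scaleR_right)
qed

text \<open>In the resolvent identity the factor depending on \<open>t\<close> is uniformly bounded,
  so the difference is at most a constant times \<open>\<bar>t - s\<bar>\<close>.\<close>

lemma isCont_resolvent: "isCont (resolvent A) s"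
proof -
  obtain K where K: "\<And>(a::real^'n^'n) (b::real^'n^'n). norm (a ** b) \<le> norm a * norm b * K" and "K \<ge> 0"
    using matrix_mult.nonneg_bounded by blast
  have "((\<lambda>t. (t - s) *\<^sub>R (resolvent A t ** A ** resolvent A s)) \<longlongrightarrow> 0) (at s)"
  proof (rule tendsto_norm_zero_cancel, rule Lim_null_comparison)
    show "\<forall>\<^sub>F t in at s. norm (norm ((t - s) *\<^sub>R (resolvent A t ** A ** resolvent A s)))
       \<le> \<bar>t - s\<bar> * ((CARD('n) * CARD('n)) * norm (A ** resolvent A s) * K)"
    proof (intro always_eventually allI)
      fix t
      have "norm (resolvent A t ** (A ** resolvent A s)) \<le> norm (resolvent A t) * norm (A ** resolvent A s) * K"
        by (rule K)
      also have "\<dots> \<le> (CARD('n) * CARD('n)) * norm (A ** resolvent A s) * K"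
        by (intro mult_mono norm_resolvent_le) (use \<open>K \<ge> 0\<close> in auto)
      finally show "norm (norm ((t - s) *\<^sub>R (resolvent A t ** A ** resolvent A s)))
          \<le> \<bar>t - s\<bar> * ((CARD('n) * CARD('n)) * norm (A ** resolvent A s) * K)"
        by (auto simp: matrix_mul_assoc intro!: mult_left_mono)
    qed
    have "((\<lambda>t. \<bar>t - s\<bar> * c) \<longlongrightarrow> \<bar>s - s\<bar> * c) (at s)" for c :: real
      by (intro tendsto_intros)
    then show "((\<lambda>t. \<bar>t - s\<bar> * ((CARD('n) * CARD('n)) * norm (A ** resolvent A s) * K)) \<longlongrightarrow> 0) (at s)"
      by simp
  qed
  then have "((\<lambda>t. resolvent A t - resolvent A s) \<longlongrightarrow> 0) (at s)"
    by (simp only: resolvent_diff)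
  then show ?thesis by (simp add: isCont_def LIM_zero_iff)
qed

lemma resolvent_has_vector_derivative:
  "(resolvent A has_vector_derivative resolvent A s ** A ** resolvent A s) (at s)"
proof -
  have "((\<lambda>t. resolvent A t ** A ** resolvent A s) \<longlongrightarrow> resolvent A s ** A ** resolvent A s) (at s)"
    by (intro matrix_mult.tendsto tendsto_const isCont_resolvent[unfolded isCont_def])
  then show ?thesis
    by (rule has_vector_derivative_slopeI[OF resolvent_diff])
qed

text \<open>Bootstrapping: the derivative is \<open>resolvent A s ** A ** resolvent A s\<close>, a
  product of maps already known to be of order \<open>k\<close>, so the resolvent is of order
  \<open>k + 1\<close>.\<close>

lemma smooth_on_resolvent: "smooth_on UNIV (resolvent A)"
  unfolding smooth_on_def
proof
  fix k show "Ck_on k UNIV (resolvent A)"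
  proof (induction k)
    case 0
    then show ?case by (simp add: continuous_at_imp_continuous_on isCont_resolvent)
  next
    case (Suc k)
    show ?case
      by (rule Ck_on_SucI[OF open_UNIV resolvent_has_vector_derivative[unfolded has_vector_derivative_def]])
         (intro Ck_on_bounded_linear[OF _ bounded_linear_scaleR_right] open_UNIV
           Ck_on_bilinear[OF bounded_bilinear_matrix_mult] Ck_on_const Suc.IH)
  qed
qed

text \<open>
  The Cayley transform \<open>(1 - sA)\<^sup>-\<^sup>1(1 + sA) = 2(1 - sA)\<^sup>-\<^sup>1 - 1\<close> with \<open>s = t/2\<close>.
\<close>

lemma cayley_curve:
  obtains Q where "smooth_on UNIV Q" "\<And>t. orthogonal_matrix (Q t)" "Q 0 = mat 1"
    "(Q has_vector_derivative A) (at 0)"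
proof -
  \<comment> \<open>Halving the parameter offsets the factor 2, so that the velocity at 0 is exactly
    \<open>A\<close>.\<close>
  define Q where "Q t = 2 *\<^sub>R resolvent A (t / 2) - mat 1" for t
  have sm: "smooth_on UNIV Q"
  proof -
    have "Ck_on k UNIV (\<lambda>t. resolvent A (t / 2))" for k
    proof (rule Ck_on_compose[OF open_UNIV open_UNIV subset_UNIV, where f = "\<lambda>t. t / 2"])
      show "Ck_on k UNIV (\<lambda>t::real. t / 2)"
        by (rule Ck_on_bounded_linear[OF open_UNIV bounded_linear_divide Ck_on_ident[OF open_UNIV]])
      show "Ck_on k UNIV (resolvent A)" using smooth_on_resolvent by (simp add: smooth_on_def)
    qed
    then have "Ck_on k UNIV (\<lambda>t. 2 *\<^sub>R resolvent A (t / 2) + - mat 1)" for k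
      by (intro Ck_on_add Ck_on_const Ck_on_bounded_linear[OF _ bounded_linear_scaleR_right] open_UNIV)
    then show ?thesis by (simp add: smooth_on_def Q_def[abs_def] del: Ck_on.simps)
  qed
  have r0: "resolvent A 0 = mat 1" using resolvent_inverse(1)[of 0] by simp
  have orth: "orthogonal_matrix (Q t)" for t
  proof -
    let ?B = "resolvent A (t / 2)" and ?T = "(t / 2) *\<^sub>R A"
    have B: "?B - ?T ** ?B = mat 1"
      using resolvent_inverse(1)[of "t/2"] by (simp add: matrix_mult.diff_left)
    then have "transpose (?B - ?T ** ?B) = transpose (mat 1)" by simp
    then have B': "transpose ?B + transpose ?B ** ?T = mat 1"
      by (simp add: transpose_diff matrix_transpose_mul transpose_scalar skew
          matrix_mult.minus_right matrix_mult.scaleR_right)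
    \<comment> \<open>In this combination of \<open>B\<close> and \<open>B'\<close> the terms with
      \<open>?T\<close> cancel. With both brackets equal to the identity, what remains is the
      orthogonality relation for \<open>2 *\<^sub>R ?B - mat 1\<close>.\<close>
    have "transpose ?B ** (?B - ?T ** ?B) + (transpose ?B + transpose ?B ** ?T) ** ?B
        = 2 *\<^sub>R (transpose ?B ** ?B)"
      by (simp add: matrix_mult.diff_right matrix_mult.add_left matrix_mul_assoc scaleR_2)
    then have "transpose ?B + ?B = 2 *\<^sub>R (transpose ?B ** ?B)" unfolding B B' by simp
    then have "transpose (Q t) ** Q t = mat 1"
      unfolding Q_def
      by (simp add: transpose_diff transpose_scalar matrix_mult.diff_left matrix_mult.diff_right
          matrix_mult.scaleR_left matrix_mult.scaleR_right flip: scaleR_add_right)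
         (simp add: algebra_simps)
    then show ?thesis by (simp add: orthogonal_matrix)
  qed
  have "((\<lambda>t. resolvent A (t / 2)) has_vector_derivative (1/2) *\<^sub>R A) (at 0)"
  proof -
    have "((\<lambda>t::real. t / 2) has_vector_derivative 1/2) (at 0)"
      by (auto intro!: derivative_eq_intros simp flip: has_real_derivative_iff_has_vector_derivative)
    from vector_diff_chain_at[OF this, of "resolvent A"] resolvent_has_vector_derivative[of 0]
    show ?thesis by (simp add: r0 o_def)
  qed
  then have "(Q has_vector_derivative 2 *\<^sub>R ((1/2) *\<^sub>R A) - 0) (at 0)"
    unfolding Q_def[abs_def]
    by (intro has_vector_derivative_diff bounded_linear.has_vector_derivative[OF bounded_linear_scaleR_right]
        has_vector_derivative_const)
  then have "(Q has_vector_derivative A) (at 0)" by simp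
  moreover have "Q 0 = mat 1" by (simp add: Q_def r0 scaleR_2)
  ultimately show ?thesis using that[OF sm orth] by blast
qed

end

section \<open>Tangent vectors of the product of orthogonal groups\<close>

lemma bounded_linear_row_block:
  "bounded_linear (\<lambda>X :: ('n::finite, 'd::finite) stacked. row_block X i)"
  by (auto intro!: linearI simp: linear_conv_bounded_linear[symmetric] row_block_def vec_eq_iff)

lemmas row_block_diff = linear_diff[OF bounded_linear.linear[OF bounded_linear_row_block]]
lemmas row_block_scaleR = linear_cmul[OF bounded_linear.linear[OF bounded_linear_row_block]]

lemma row_block_mult: "row_block (X ** Q) i = row_block X i ** Q"
  by (simp add: row_block_def matrix_matrix_mult_def vec_eq_iff)

lemma row_block_eqI: "(\<And>i. row_block X i = row_block Y i) \<Longrightarrow> X = Y"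
  by (simp add: row_block_def vec_eq_iff)

lemma block_mult_transpose: "block (X ** transpose Y) i j = row_block X i ** transpose (row_block Y j)"
  by (simp add: row_block_def block_def matrix_matrix_mult_def transpose_def vec_eq_iff)

lemma transpose_mult_row_blocks:
  fixes X Y :: "('n::finite, 'd::finite) stacked"
  shows "transpose X ** Y = (\<Sum>i\<in>UNIV. transpose (row_block X i) ** row_block Y i)"
  by (simp add: row_block_def matrix_matrix_mult_def transpose_def vec_eq_iff sum.cartesian_product
      flip: UNIV_Times_UNIV)

text \<open>In block row \<open>i\<close> of \<open>symblockdiag M\<close> only the diagonal block
  is nonzero, so left multiplication acts on each row block separately.\<close>

lemma row_block_symblockdiag_mult:
  fixes M :: "('n::finite, 'd::finite) blockmat" and X :: "('n, 'd) stacked"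
  shows "row_block (symblockdiag M ** X) i
    = ((1 / 2) *\<^sub>R (block M i i + transpose (block M i i))) ** row_block X i"
proof -
  have "(\<Sum>q\<in>UNIV. symblockdiag M $ (i, a) $ q * X $ q $ b)
      = (\<Sum>c\<in>UNIV. ((1 / 2) *\<^sub>R (block M i i + transpose (block M i i))) $ a $ c * X $ (i, c) $ b)" for a b
  proof -
    let ?g = "\<lambda>j c. symblockdiag M $ (i, a) $ (j, c) * X $ (j, c) $ b"
    have "(\<Sum>q\<in>UNIV. symblockdiag M $ (i, a) $ q * X $ q $ b) = (\<Sum>j\<in>UNIV. \<Sum>c\<in>UNIV. ?g j c)"
      by (simp add: sum.cartesian_product case_prod_unfold flip: UNIV_Times_UNIV)
    also have "\<dots> = (\<Sum>c\<in>UNIV. ?g i c)"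
      by (subst sum.remove[of _ i]) (auto intro!: sum.neutral simp: symblockdiag_def)
    finally show ?thesis by (simp add: symblockdiag_def)
  qed
  then show ?thesis by (simp add: row_block_def matrix_matrix_mult_def vec_eq_iff)
qed

lemma frob_eq_inner: "frob X Y = X \<bullet> Y"
  by (simp add: frob_def trace_def matrix_matrix_mult_def transpose_def inner_vec_def)
     (rule sum.swap)

lemma orth_pow_mult: "X \<in> orth_pow \<Longrightarrow> orthogonal_matrix Q \<Longrightarrow> X ** Q \<in> orth_pow"
  by (simp add: orth_pow_def row_block_mult orthogonal_matrix_mul)

lemma orth_pow_row_block:
  assumes "G \<in> orth_pow"
  shows "transpose (row_block G i) ** row_block G i = mat 1"
    and "row_block G i ** transpose (row_block G i) = mat 1"
  using assms by (auto simp: orth_pow_def orthogonal_matrix_def)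

lemma curve_in_linear_image:
  assumes "bounded_linear L" "curve_in M x v \<gamma>" "\<And>y. y \<in> M \<Longrightarrow> L y \<in> N"
  shows "curve_in N (L x) (L v) (\<lambda>t. L (\<gamma> t))"
proof -
  obtain e where "e > 0" "smooth_on {-e<..<e} \<gamma>" "\<gamma> ` {-e<..<e} \<subseteq> M"
    and g: "\<gamma> 0 = x" "(\<gamma> has_vector_derivative v) (at 0)"
    using assms(2) unfolding curve_in_def by auto
  moreover have "smooth_on {-e<..<e} (\<lambda>t. L (\<gamma> t))"
    by (rule smooth_on_bounded_linear[OF _ assms(1)]) (use calculation in auto)
  ultimately have "\<exists>e>0. smooth_on {-e<..<e} (\<lambda>t. L (\<gamma> t)) \<and> (\<lambda>t. L (\<gamma> t)) ` {-e<..<e} \<subseteq> N"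
    using assms(3) by blast
  then show ?thesis
    unfolding curve_in_def using g bounded_linear.has_vector_derivative[OF assms(1) g(2)] by blast
qed

lemma curve_in_subset: "curve_in M x v \<gamma> \<Longrightarrow> M \<subseteq> N \<Longrightarrow> curve_in N x v \<gamma>"
  unfolding curve_in_def by blast

lemma curve_in_restrict:
  "curve_in M x v \<gamma> \<Longrightarrow> (\<And>t. P (\<gamma> t)) \<Longrightarrow> curve_in {X \<in> M. P X} x v \<gamma>"
  unfolding curve_in_def image_subset_iff mem_Collect_eq by blast

text \<open>Both orthogonality relations of a block are differentiated. The first result matches
  left rotations of single blocks and pairs with symmetric diagonal blocks; the second matches the
  right action on all blocks and yields vertical vectors.\<close>

lemma tangent_space_skew:
  assumes v: "v \<in> tangent_space orth_pow G"
  shows "transpose (row_block v i ** transpose (row_block G i)) = - (row_block v i ** transpose (row_block G i))"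
    and "transpose (transpose (row_block v i) ** row_block G i) = - (transpose (row_block v i) ** row_block G i)"
proof -
  obtain \<gamma> where c: "curve_in orth_pow G v \<gamma>" using v unfolding tangent_space_def by auto
  then have g: "\<gamma> 0 = G" "(\<gamma> has_vector_derivative v) (at 0)" unfolding curve_in_def by auto
  have r: "((\<lambda>t. row_block (\<gamma> t) i) has_vector_derivative row_block v i) (at 0)"
    using bounded_linear.has_vector_derivative[OF bounded_linear_row_block g(2)] .
  note rt = bounded_linear.has_vector_derivative[OF bounded_linear_transpose r]
  have ev: "\<forall>\<^sub>F t in nhds 0. \<gamma> t \<in> orth_pow" by (rule curve_in_eventually[OF c])
  have "\<forall>\<^sub>F t in nhds 0. row_block (\<gamma> t) i ** transpose (row_block (\<gamma> t) i) = mat 1"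
    using ev by eventually_elim (rule orth_pow_row_block)
  from has_vector_derivative_eventually_eq[OF matrix_mult.has_vector_derivative[OF r rt] this]
  have 1: "row_block G i ** transpose (row_block v i) + row_block v i ** transpose (row_block G i) = 0"
    using vector_derivative_unique_at[OF _ has_vector_derivative_const] g(1) by fastforce
  have "\<forall>\<^sub>F t in nhds 0. transpose (row_block (\<gamma> t) i) ** row_block (\<gamma> t) i = mat 1"
    using ev by eventually_elim (rule orth_pow_row_block)
  from has_vector_derivative_eventually_eq[OF matrix_mult.has_vector_derivative[OF rt r] this]
  have 2: "transpose (row_block G i) ** row_block v i + transpose (row_block v i) ** row_block G i = 0"
    using vector_derivative_unique_at[OF _ has_vector_derivative_const] g(1) by fastforce
  show "transpose (row_block v i ** transpose (row_block G i)) = - (row_block v i ** transpose (row_block G i))"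
    "transpose (transpose (row_block v i) ** row_block G i) = - (transpose (row_block v i) ** row_block G i)"
    using 1 2 by (simp_all add: matrix_transpose_mul eq_neg_iff_add_eq_0)
qed

lemma tangent_spaceI:
  fixes v G :: "('n::finite, 'd::finite) stacked"
  assumes G: "G \<in> orth_pow"
    and skew: "\<And>i. transpose (row_block v i ** transpose (row_block G i)) = - (row_block v i ** transpose (row_block G i))"
  shows "v \<in> tangent_space orth_pow G"
proof -
  define A where "A i = row_block v i ** transpose (row_block G i)" for i
  have "\<exists>Q. smooth_on UNIV Q \<and> (\<forall>t. orthogonal_matrix (Q t)) \<and> Q 0 = mat 1 \<and>
      (Q has_vector_derivative A i) (at 0)" for i
    using cayley_curve[of "A i"] skew[of i] unfolding A_def by metis
  then obtain Q where Q: "\<And>i. smooth_on UNIV (Q i)" "\<And>i t. orthogonal_matrix (Q i t)"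
    "\<And>i. Q i 0 = mat 1" "\<And>i. (Q i has_vector_derivative A i) (at 0)"
    by metis
  \<comment> \<open>Each block is rotated from the left by its own Cayley curve. The velocity of
    block \<open>i\<close> is \<open>A i ** row_block G i\<close>, which is
    \<open>row_block v i\<close> because the block of \<open>G\<close> is orthogonal.\<close>
  define \<gamma> :: "real \<Rightarrow> ('n, 'd) stacked"
    where "\<gamma> t = (\<chi> p. (Q (fst p) t ** row_block G (fst p)) $ snd p)" for t
  have rb: "row_block (\<gamma> t) i = Q i t ** row_block G i" for t i
    by (simp add: \<gamma>_def row_block_def vec_eq_iff)
  have Av: "A i ** row_block G i = row_block v i" for i
    by (simp add: A_def orth_pow_row_block[OF G] flip: matrix_mul_assoc)
  have "smooth_on UNIV \<gamma>"
  proof (rule smooth_on_componentwise[OF open_UNIV])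
    fix b :: "('n, 'd) stacked" assume "b \<in> Basis"
    then obtain i a c where b: "b = axis (i, a) (axis c 1)" by (auto simp: Basis_vec_def)
    have "(\<lambda>t. \<gamma> t \<bullet> b) = (\<lambda>t. (Q i t ** row_block G i) \<bullet> axis a (axis c 1))"
      by (simp add: b \<gamma>_def inner_axis)
    then show "smooth_on UNIV (\<lambda>t. \<gamma> t \<bullet> b)"
      by (simp add: smooth_on_bounded_linear[OF open_UNIV bounded_linear_inner_left]
          smooth_on_bounded_linear[OF open_UNIV matrix_mult.bounded_linear_left] Q)
  qed
  moreover have "\<gamma> t \<in> orth_pow" for t
    using G Q(2) by (simp add: orth_pow_def rb orthogonal_matrix_mul)
  moreover have "\<gamma> 0 = G" by (rule row_block_eqI) (simp add: rb Q)
  moreover have "(\<gamma> has_vector_derivative v) (at 0)"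
    unfolding has_vector_derivative_def
  proof (subst has_derivative_componentwise_within, intro ballI)
    fix b :: "('n, 'd) stacked" assume "b \<in> Basis"
    then obtain i a c where b: "b = axis (i, a) (axis c 1)" by (auto simp: Basis_vec_def)
    have "(\<lambda>t. \<gamma> t \<bullet> b) = (\<lambda>t. (Q i t ** row_block G i) \<bullet> axis a (axis c 1))"
      by (simp add: b \<gamma>_def inner_axis)
    moreover have "((\<lambda>t. (Q i t ** row_block G i) \<bullet> axis a (axis c 1)) has_vector_derivative
        (A i ** row_block G i) \<bullet> axis a (axis c 1)) (at 0)"
      by (intro bounded_linear.has_vector_derivative[OF bounded_linear_inner_left]
          bounded_linear.has_vector_derivative[OF matrix_mult.bounded_linear_left] Q)
    moreover have "(A i ** row_block G i) \<bullet> axis a (axis c 1) = v \<bullet> b"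
      unfolding Av b by (simp add: inner_axis row_block_def)
    ultimately show "((\<lambda>t. \<gamma> t \<bullet> b) has_derivative (\<lambda>t. t *\<^sub>R v \<bullet> b)) (at 0)"
      by (simp add: has_vector_derivative_def)
  qed
  ultimately have "curve_in orth_pow G v \<gamma>"
    unfolding curve_in_def by (auto intro!: exI[of _ 1] intro: smooth_on_subset)
  then show ?thesis unfolding tangent_space_def by blast
qed

text \<open>Moving along the fibres while following \<open>\<gamma>\<close> changes the velocity by
  \<open>G ** W\<close> and leaves the projected curve unchanged. A constant \<open>\<gamma>\<close>
  gives vertical curves; a general one gives horizontal corrections.\<close>

lemma curve_in_orth_pow_mult:
  assumes "curve_in orth_pow G v \<gamma>" "smooth_on UNIV Q" "\<And>t. orthogonal_matrix (Q t)" "Q 0 = mat 1"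
    "(Q has_vector_derivative W) (at 0)"
  shows "curve_in orth_pow G (v + G ** W) (\<lambda>t. \<gamma> t ** Q t)"
proof -
  obtain e where e: "e > 0" "smooth_on {-e<..<e} \<gamma>" "\<gamma> ` {-e<..<e} \<subseteq> orth_pow"
    and g: "\<gamma> 0 = G" "(\<gamma> has_vector_derivative v) (at 0)"
    using assms(1) unfolding curve_in_def by auto
  have "smooth_on {-e<..<e} (\<lambda>t. \<gamma> t ** Q t)"
    using smooth_on_subset[OF assms(2)]
    by (intro smooth_on_bilinear[OF bounded_bilinear_matrix_mult] e) auto
  moreover have "((\<lambda>t. \<gamma> t ** Q t) has_vector_derivative v + G ** W) (at 0)"
    using matrix_mult.has_vector_derivative[OF g(2) assms(5)] g(1) assms(4) by (simp add: add.commute)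
  ultimately show ?thesis
    unfolding curve_in_def using e g assms(3,4) orth_pow_mult by (auto intro!: exI[of _ e])
qed

lemma curve_in_const: "x \<in> M \<Longrightarrow> curve_in M x 0 (\<lambda>t. x)"
  unfolding curve_in_def by (auto intro!: exI[of _ 1] smooth_on_const)


section \<open>The quotient by the orthogonal group\<close>

lemma mem_proj_self: "X \<in> proj X"
  unfolding proj_def using orthogonal_matrix_id by (force intro: exI[of _ "mat 1"])

lemma proj_mult:
  assumes Q: "orthogonal_matrix Q"
  shows "proj (X ** Q) = proj X"
proof
  show "proj (X ** Q) \<subseteq> proj X"
    unfolding proj_def using orthogonal_matrix_mul[OF Q] by (force simp flip: matrix_mul_assoc)
  have "X ** R = X ** Q ** (transpose Q ** R)" for R
    using Q by (simp add: matrix_mul_assoc orthogonal_matrix_def) (simp add: orthogonal_matrix_def flip: matrix_mul_assoc)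
  moreover have "orthogonal_matrix (transpose Q ** R)" if "orthogonal_matrix R" for R
    using Q that by (simp add: orthogonal_matrix_mul)
  ultimately show "proj X \<subseteq> proj (X ** Q)"
    unfolding proj_def by blast
qed

lemma induced_proj:
  assumes "\<And>Q. orthogonal_matrix Q \<Longrightarrow> F (X ** Q) = F X"
  shows "induced F (proj X) = F X"
  unfolding induced_def
proof (rule the_equality)
  show "\<forall>G\<in>proj X. F G = F X" using assms by (auto simp: proj_def)
  show "r = F X" if "\<forall>G\<in>proj X. F G = r" for r using that mem_proj_self[of X] by simp
qed

text \<open>
  The representative of the class of \<open>X\<close> having the same block \<open>i\<close> as \<open>H\<close>. As a function of the
  class, it is a global smooth section of \<^const>\<open>proj\<close>.
\<close>

definition normal_form :: "'n \<Rightarrow> ('n::finite, 'd::finite) stacked \<Rightarrow> ('n, 'd) stacked \<Rightarrow> ('n, 'd) stacked"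
  where "normal_form i H X = X ** transpose (row_block X i) ** row_block H i"

lemma normal_form_mult: "orthogonal_matrix Q \<Longrightarrow> normal_form i H (X ** Q) = normal_form i H X"
  unfolding normal_form_def row_block_mult matrix_transpose_mul orthogonal_matrix_def
  by (metis matrix_mul_assoc matrix_mul_rid)

lemma normal_form_self: "H \<in> orth_pow \<Longrightarrow> normal_form i H H = H"
  by (simp add: normal_form_def orth_pow_row_block flip: matrix_mul_assoc)

lemma normal_form_orth_pow:
  assumes "H \<in> orth_pow" "X \<in> orth_pow"
  shows "normal_form i H X \<in> orth_pow" "proj (normal_form i H X) = proj X"
proof -
  have "orthogonal_matrix (transpose (row_block X i) ** row_block H i)"
    using assms by (simp add: orth_pow_def orthogonal_matrix_mul)
  then show "normal_form i H X \<in> orth_pow" "proj (normal_form i H X) = proj X"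
    using assms by (simp_all add: normal_form_def orth_pow_mult proj_mult flip: matrix_mul_assoc)
qed

lemma smooth_on_normal_form: "smooth_on UNIV (normal_form i H)"
  unfolding normal_form_def[abs_def]
  by (intro smooth_on_bilinear[OF bounded_bilinear_matrix_mult] smooth_on_ident smooth_on_const open_UNIV
      smooth_on_bounded_linear[OF _ bounded_linear_transpose] smooth_on_bounded_linear[OF _ bounded_linear_row_block])

text \<open>The product rule gives two terms; in one of them the orthogonality of block
  \<open>i\<close> of \<open>G\<close> restores \<open>v\<close>, and the other has the form
  \<open>G ** W\<close>.\<close>

lemma normal_form_has_vector_derivative:
  assumes "(\<gamma> has_vector_derivative v) (at 0)" "\<gamma> 0 = G" "G \<in> orth_pow"
  shows "((\<lambda>t. normal_form i G (\<gamma> t)) has_vector_derivative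
    v + G ** (transpose (row_block v i) ** row_block G i)) (at 0)"
proof -
  have "((\<lambda>t. \<gamma> t ** transpose (row_block (\<gamma> t) i) ** row_block G i) has_vector_derivative
     (G ** transpose (row_block v i) + v ** transpose (row_block G i)) ** row_block G i) (at 0)"
    using assms(2)
      bounded_linear.has_vector_derivative[OF matrix_mult.bounded_linear_left matrix_mult.has_vector_derivative[OF assms(1)
         bounded_linear.has_vector_derivative[OF bounded_linear_transpose
         bounded_linear.has_vector_derivative[OF bounded_linear_row_block assms(1)]]]]
    by auto
  then show ?thesis
    by (simp add: normal_form_def matrix_mult.add_left orth_pow_row_block[OF assms(3)] add.commute flip: matrix_mul_assoc)
qed

lemma smooth_fun_smooth_on: "smooth_on UNIV F \<Longrightarrow> smooth_fun M F"
  unfolding smooth_fun_def by blast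

lemma induced_normal_form: "induced (normal_form i H) (proj X) = normal_form i H X"
  by (rule induced_proj) (rule normal_form_mult)

text \<open>These coordinates are the test functions through which both smooth curves and tangent
  vectors of the quotient are recovered upstairs.\<close>

lemma normal_form_quot_smooth: "(\<lambda>c. induced (normal_form i H) c \<bullet> b) \<in> quot_smooth"
  unfolding quot_smooth_def mem_Collect_eq induced_normal_form
  by (intro smooth_fun_smooth_on smooth_on_bounded_linear[OF _ bounded_linear_inner_left]
      smooth_on_normal_form open_UNIV)

section \<open>The differential of the projection, its image and its kernel\<close>

lemma dproj_along_curve:
  assumes "curve_in orth_pow G v \<gamma>" "h \<in> quot_smooth"
  shows "((\<lambda>t. h (proj (\<gamma> t))) has_real_derivative dproj G v h) (at 0)"
proof -
  have "G \<in> orth_pow" using eventually_nhds_x_imp_x[OF curve_in_eventually[OF assms(1)]] assms(1)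
    by (simp add: curve_in_def)
  then show ?thesis
    using differential_along_curve[of orth_pow "\<lambda>X. h (proj X)" G v \<gamma>] assms
    by (simp add: dproj_def quot_smooth_def)
qed

text \<open>The base points may be different representatives. This covers both corrections of a
  velocity at one point and the transport of lifts along a fibre.\<close>

lemma dproj_eq_of_curves:
  assumes "curve_in orth_pow G v \<gamma>" "curve_in orth_pow H w \<delta>" "\<And>t. proj (\<gamma> t) = proj (\<delta> t)"
  shows "dproj G v = dproj H w"
proof
  fix h show "dproj G v h = dproj H w h"
  proof (cases "h \<in> quot_smooth")
    case True
    from dproj_along_curve[OF assms(1) this] dproj_along_curve[OF assms(2) this]
    show ?thesis unfolding assms(3) by (rule DERIV_unique)
  qed (simp add: dproj_def)
qed

lemma dproj_in_quot_tangent_space: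
  assumes "v \<in> tangent_space orth_pow G"
  shows "dproj G v \<in> quot_tangent_space (proj G)"
proof -
  obtain \<gamma> where c: "curve_in orth_pow G v \<gamma>" using assms unfolding tangent_space_def by auto
  then obtain e where e: "e > 0" "smooth_on {-e<..<e} \<gamma>" "\<gamma> ` {-e<..<e} \<subseteq> orth_pow" "\<gamma> 0 = G"
    unfolding curve_in_def by auto
  have "smooth_on {-e<..<e} (\<lambda>t. h (proj (\<gamma> t)))" if "h \<in> quot_smooth" for h
    using smooth_fun_smooth_curve[of orth_pow "\<lambda>X. h (proj X)" "{-e<..<e}" \<gamma>] e that
    by (simp add: quot_smooth_def)
  then have "quot_curve (proj G) (\<lambda>t. proj (\<gamma> t))"
    unfolding quot_curve_def quot_def using e by (auto intro!: exI[of _ e])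
  moreover have "dproj G v = (\<lambda>h \<in> quot_smooth. deriv (\<lambda>t. h (proj (\<gamma> t))) 0)"
    using DERIV_imp_deriv[OF dproj_along_curve[OF c]] by (auto simp: dproj_def)
  ultimately show ?thesis unfolding quot_tangent_space_def by (intro CollectI exI conjI)
qed

text \<open>Surjectivity of the differential of the projection: the normal forms of the classes
  \<open>c t\<close> make up a curve upstairs whose coordinates are test functions along
  \<open>c\<close>, hence smooth.\<close>

lemma quot_tangent_space_lift:
  fixes G :: "('n::finite, 'd::finite) stacked"
  assumes "\<eta> \<in> quot_tangent_space (proj G)" and G: "G \<in> orth_pow"
  obtains v where "v \<in> tangent_space orth_pow G" "\<eta> = dproj G v"
proof -
  obtain c where "quot_curve (proj G) c" and \<eta>: "\<eta> = (\<lambda>h \<in> quot_smooth. deriv (\<lambda>t. h (c t)) 0)"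
    using assms unfolding quot_tangent_space_def by auto
  then obtain e where e: "e > 0" "c ` {-e<..<e} \<subseteq> quot" "c 0 = proj G"
    and sm: "\<And>h. h \<in> quot_smooth \<Longrightarrow> smooth_on {-e<..<e} (\<lambda>t. h (c t))"
    unfolding quot_curve_def by auto
  \<comment> \<open>Any block can serve to normalise; \<open>undefined\<close> just names
    one.\<close>
  define i :: 'n where "i = undefined"
  define \<gamma> where "\<gamma> t = induced (normal_form i G) (c t)" for t
  have \<gamma>: "\<gamma> t \<in> orth_pow \<and> proj (\<gamma> t) = c t" if t: "t \<in> {-e<..<e}" for t
  proof -
    obtain X where "X \<in> orth_pow" "c t = proj X" using e(2) t unfolding quot_def by blast
    then show ?thesis by (simp add: \<gamma>_def induced_normal_form normal_form_orth_pow[OF G])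
  qed
  have g0: "\<gamma> 0 = G" by (simp add: \<gamma>_def e induced_normal_form normal_form_self[OF G])
  have gs: "smooth_on {-e<..<e} \<gamma>"
    unfolding \<gamma>_def
    by (rule smooth_on_componentwise[OF _ sm[OF normal_form_quot_smooth]]) simp
  then have "\<gamma> differentiable at 0" using e(1) by (intro smooth_on_differentiable) auto
  then obtain v where v: "(\<gamma> has_vector_derivative v) (at 0)"
    using vector_derivative_works by blast
  have curve: "curve_in orth_pow G v \<gamma>"
    unfolding curve_in_def using e(1) gs g0 v \<gamma> by blast
  \<comment> \<open>Only near 0 is \<open>c\<close> known to stay in the quotient, so the two curves
    of classes are compared there.\<close>
  have ev: "\<forall>\<^sub>F t in nhds 0. proj (\<gamma> t) = c t"
    using e(1) \<gamma> by (intro eventually_nhds_in_open[of "{-e<..<e}" 0, THEN eventually_mono]) auto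
  have "dproj G v h = deriv (\<lambda>t. h (c t)) 0" if "h \<in> quot_smooth" for h
  proof -
    have "((\<lambda>t. h (proj (\<gamma> t))) has_vector_derivative dproj G v h) (at 0)"
      using dproj_along_curve[OF curve that] by (simp add: has_real_derivative_iff_has_vector_derivative)
    then have "((\<lambda>t. h (c t)) has_vector_derivative dproj G v h) (at 0)"
      by (rule has_vector_derivative_eventually_eq) (use ev in eventually_elim, simp)
    then show ?thesis
      by (simp add: DERIV_imp_deriv has_real_derivative_iff_has_vector_derivative)
  qed
  then have "\<eta> = dproj G v" unfolding \<eta> by (auto simp: dproj_def)
  then show ?thesis using that curve unfolding tangent_space_def by blast
qed

lemma mult_skew_in_vertical_space:
  assumes "G \<in> orth_pow" "transpose W = - W"
  shows "G ** W \<in> vertical_space G"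
proof -
  obtain Q where Q: "smooth_on UNIV Q" "\<And>t. orthogonal_matrix (Q t)" "Q 0 = mat 1"
    "(Q has_vector_derivative W) (at 0)"
    using cayley_curve[OF assms(2)] by metis
  have "curve_in {X \<in> orth_pow. proj X = proj G} G (G ** W) (\<lambda>t. G ** Q t)"
    using curve_in_orth_pow_mult[OF curve_in_const[OF assms(1)] Q]
    by (intro curve_in_restrict) (simp_all add: proj_mult Q)
  then show ?thesis unfolding vertical_space_def tangent_space_def by blast
qed

text \<open>The normal form is constant along a curve in the fibre; setting its derivative to zero
  expresses \<open>w\<close> as a multiple of \<open>G\<close> from the right.\<close>

lemma vertical_spaceE:
  fixes G :: "('n::finite, 'd::finite) stacked"
  assumes "w \<in> vertical_space G" "G \<in> orth_pow"
  obtains W where "w = G ** W"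
proof -
  obtain \<gamma> where c: "curve_in {X \<in> orth_pow. proj X = proj G} G w \<gamma>"
    using assms unfolding vertical_space_def tangent_space_def by auto
  define i :: 'n where "i = undefined"
  have "\<forall>\<^sub>F t in nhds 0. normal_form i G (\<gamma> t) = G"
    using curve_in_eventually[OF c]
  proof eventually_elim
    case (elim t)
    then have "induced (normal_form i G) (proj (\<gamma> t)) = induced (normal_form i G) (proj G)" by simp
    then show ?case by (simp add: induced_normal_form normal_form_self[OF assms(2)])
  qed
  from has_vector_derivative_eventually_eq[OF normal_form_has_vector_derivative[OF _ _ assms(2)] this]
  have "((\<lambda>t. G) has_vector_derivative w + G ** (transpose (row_block w i) ** row_block G i)) (at 0)"
    using c unfolding curve_in_def by auto
  then have "w + G ** (transpose (row_block w i) ** row_block G i) = 0"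
    using vector_derivative_unique_at has_vector_derivative_const by blast
  then have "w = G ** (- (transpose (row_block w i) ** row_block G i))"
    by (simp add: matrix_mult.minus_right eq_neg_iff_add_eq_0)
  then show ?thesis using that by blast
qed

text \<open>Applied to the normal form coordinates, the image of \<open>u\<close> reveals
  \<open>u + G ** (transpose (row_block u i) ** row_block G i)\<close>. Equality for
  \<open>v\<close> and \<open>w\<close> leaves \<open>v - w\<close> as \<open>G\<close> times a
  difference of skew matrices.\<close>

lemma dproj_eq_imp_vertical:
  fixes G :: "('n::finite, 'd::finite) stacked"
  assumes G: "G \<in> orth_pow" and v: "v \<in> tangent_space orth_pow G" and w: "w \<in> tangent_space orth_pow G"
    and eq: "dproj G v = dproj G w"
  shows "v - w \<in> vertical_space G"
proof -
  define i :: 'n where "i = undefined"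
  let ?h = "\<lambda>b c. induced (normal_form i G) c \<bullet> b"
  have d: "dproj G u (?h b) = (u + G ** (transpose (row_block u i) ** row_block G i)) \<bullet> b"
    if u: "u \<in> tangent_space orth_pow G" for u b
  proof -
    obtain \<gamma> where c: "curve_in orth_pow G u \<gamma>" using u unfolding tangent_space_def by auto
    have "((\<lambda>t. normal_form i G (\<gamma> t) \<bullet> b) has_vector_derivative
        (u + G ** (transpose (row_block u i) ** row_block G i)) \<bullet> b) (at 0)"
      using c G unfolding curve_in_def
      by (intro bounded_linear.has_vector_derivative[OF bounded_linear_inner_left]
          normal_form_has_vector_derivative) auto
    moreover have "((\<lambda>t. normal_form i G (\<gamma> t) \<bullet> b) has_real_derivative dproj G u (?h b)) (at 0)"
      using dproj_along_curve[OF c normal_form_quot_smooth[of i G b]] by (simp only: induced_normal_form)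
    ultimately show ?thesis
      by (simp only: DERIV_unique flip: has_real_derivative_iff_has_vector_derivative)
  qed
  have "v + G ** (transpose (row_block v i) ** row_block G i)
      = w + G ** (transpose (row_block w i) ** row_block G i)"
    by (rule euclidean_eqI) (simp add: eq flip: d[OF v] d[OF w])
  then have "v - w = G ** (transpose (row_block w i) ** row_block G i - transpose (row_block v i) ** row_block G i)"
    by (simp add: matrix_mult.diff_right algebra_simps)
  moreover have "\<dots> \<in> vertical_space G"
    by (rule mult_skew_in_vertical_space[OF G])
       (simp add: transpose_diff tangent_space_skew(2)[OF v] tangent_space_skew(2)[OF w])
  ultimately show ?thesis by simp
qed

section \<open>Horizontal lifts and the quotient metric\<close>

lemma horizontal_lift_unique:
  assumes "G \<in> orth_pow" "is_horizontal_lift G \<xi> v" "is_horizontal_lift G \<xi> w"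
  shows "v = w"
proof -
  have "v - w \<in> vertical_space G"
    using assms by (intro dproj_eq_imp_vertical) (auto simp: is_horizontal_lift_def horizontal_space_def)
  \<comment> \<open>The difference is vertical while \<open>v\<close> and \<open>w\<close> are
    orthogonal to vertical vectors, so it is orthogonal to itself.\<close>
  then have "frob v (v - w) = 0" "frob w (v - w) = 0"
    using assms(2,3) by (auto simp: is_horizontal_lift_def horizontal_space_def)
  then have "(v - w) \<bullet> (v - w) = 0" unfolding frob_eq_inner by (simp add: inner_diff_left)
  then show ?thesis by simp
qed

lemma horizontal_lift_eq: "G \<in> orth_pow \<Longrightarrow> is_horizontal_lift G \<xi> v \<Longrightarrow> horizontal_lift G \<xi> = v"
  unfolding horizontal_lift_def using horizontal_lift_unique by blast

lemma horizontal_spaceI: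
  assumes "G \<in> orth_pow" "v \<in> tangent_space orth_pow G" "transpose v ** G = 0"
  shows "v \<in> horizontal_space G"
proof -
  have "frob v w = 0" if w: "w \<in> vertical_space G" for w
  proof -
    obtain W where "w = G ** W" using vertical_spaceE[OF w assms(1)] .
    then show ?thesis by (simp add: frob_def matrix_mul_assoc assms(3)) (simp add: trace_def)
  qed
  then show ?thesis using assms(2) by (simp add: horizontal_space_def)
qed

lemma ex_horizontal_lift:
  fixes G :: "('n::finite, 'd::finite) stacked"
  assumes "\<eta> \<in> quot_tangent_space (proj G)" and G: "G \<in> orth_pow"
  obtains v where "is_horizontal_lift G \<eta> v"
proof -
  obtain v where v: "v \<in> tangent_space orth_pow G" and \<eta>: "\<eta> = dproj G v"
    using quot_tangent_space_lift[OF assms] .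
  then obtain \<gamma> where c: "curve_in orth_pow G v \<gamma>" unfolding tangent_space_def by auto
  \<comment> \<open>Horizontality asks for \<open>transpose (v + G ** W) ** G = 0\<close>. As
    \<open>W\<close> is skew and \<open>transpose G ** G\<close> is the identity times the number of
    blocks, this forces the factor \<open>1 / real CARD('n)\<close>.\<close>
  define W where "W = (1 / real CARD('n)) *\<^sub>R (transpose v ** G)"
  have skew: "transpose W = - W"
  proof -
    have "transpose (transpose v ** G) = - (transpose v ** G)"
      unfolding transpose_mult_row_blocks[of v]
      by (simp add: linear_sum[OF bounded_linear.linear[OF bounded_linear_transpose]] tangent_space_skew(2)[OF v] sum_negf)
    then show ?thesis by (simp add: W_def transpose_scalar)
  qed
  obtain Q where Q: "smooth_on UNIV Q" "\<And>t. orthogonal_matrix (Q t)" "Q 0 = mat 1"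
    "(Q has_vector_derivative W) (at 0)"
    using cayley_curve[OF skew] by metis
  note c' = curve_in_orth_pow_mult[OF c Q]
  have "transpose G ** G = real CARD('n) *\<^sub>R mat 1"
    unfolding transpose_mult_row_blocks by (simp only: orth_pow_row_block[OF G] sum_constant_scaleR)
  then have "transpose (v + G ** W) ** G = transpose v ** G - real CARD('n) *\<^sub>R W"
    by (simp add: transpose_add matrix_transpose_mul skew matrix_mult.diff_left matrix_mult.add_left matrix_mult.minus_left
        matrix_mult.scaleR_right flip: matrix_mul_assoc)
  also have "\<dots> = 0" by (simp add: W_def)
  finally have "v + G ** W \<in> horizontal_space G"
    using c' by (intro horizontal_spaceI[OF G]) (auto simp: tangent_space_def)
  moreover have "dproj G (v + G ** W) = \<eta>"
    unfolding \<eta> by (rule dproj_eq_of_curves[OF c' c]) (simp add: proj_mult Q)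
  ultimately show ?thesis using that unfolding is_horizontal_lift_def by blast
qed

lemma frob_mult_orthogonal:
  assumes "orthogonal_matrix Q" shows "frob (v ** Q) (w ** Q) = frob v w"
proof -
  have "frob (v ** Q) (w ** Q) = trace (transpose Q ** (transpose v ** w ** Q))"
    by (simp add: frob_def matrix_transpose_mul matrix_mul_assoc)
  also have "\<dots> = trace (transpose v ** w ** Q ** transpose Q)" by (rule trace_mul_sym)
  also have "\<dots> = trace (transpose v ** w ** (Q ** transpose Q))" by (simp only: matrix_mul_assoc)
  also have "\<dots> = frob v w" using assms by (simp add: frob_def orthogonal_matrix_def)
  finally show ?thesis .
qed

text \<open>Right multiplication by \<open>Q\<close> is a linear isometry that keeps every class
  fixed. It therefore carries vertical vectors to vertical ones, horizontal to horizontal, and does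
  not change the image in the quotient.\<close>

lemma is_horizontal_lift_mult:
  fixes G :: "('n::finite, 'd::finite) stacked"
  assumes Q: "orthogonal_matrix Q" and v: "is_horizontal_lift G \<xi> v"
  shows "is_horizontal_lift (G ** Q) \<xi> (v ** Q)"
proof -
  have L: "bounded_linear (\<lambda>X :: ('n, 'd) stacked. X ** R)" for R by (rule matrix_mult.bounded_linear_left)
  obtain \<gamma> where c: "curve_in orth_pow G v \<gamma>"
    using v unfolding is_horizontal_lift_def horizontal_space_def tangent_space_def by auto
  have c': "curve_in orth_pow (G ** Q) (v ** Q) (\<lambda>t. \<gamma> t ** Q)"
    by (rule curve_in_linear_image[OF L c]) (rule orth_pow_mult[OF _ Q])
  have "frob (v ** Q) w = 0" if "w \<in> vertical_space (G ** Q)" for w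
  proof -
    have Q': "orthogonal_matrix (transpose Q)" using Q by simp
    obtain \<delta> where "curve_in {X \<in> orth_pow. proj X = proj (G ** Q)} (G ** Q) w \<delta>"
      using \<open>w \<in> _\<close> unfolding vertical_space_def tangent_space_def by auto
    \<comment> \<open>A vertical vector at \<open>G ** Q\<close> is brought back to \<open>G\<close>
      by \<open>transpose Q\<close>, where horizontality of \<open>v\<close> applies.\<close>
    from curve_in_linear_image[OF L this, of "transpose Q" "{X \<in> orth_pow. proj X = proj G}"]
    have "curve_in {X \<in> orth_pow. proj X = proj G} (G ** Q ** transpose Q) (w ** transpose Q) (\<lambda>t. \<delta> t ** transpose Q)"
      using Q Q' by (simp add: orth_pow_mult proj_mult)
    moreover have "X ** Q ** transpose Q = X" "X ** transpose Q ** Q = X" for X :: "('n, 'd) stacked"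
      using Q by (simp_all add: orthogonal_matrix_def flip: matrix_mul_assoc)
    ultimately have "w ** transpose Q \<in> vertical_space G" and w: "w = w ** transpose Q ** Q"
      unfolding vertical_space_def tangent_space_def by auto
    then have "frob v (w ** transpose Q) = 0"
      using v by (simp add: is_horizontal_lift_def horizontal_space_def)
    then show ?thesis by (subst w) (simp add: frob_mult_orthogonal[OF Q])
  qed
  moreover have "dproj (G ** Q) (v ** Q) = \<xi>"
    using dproj_eq_of_curves[OF c' c] v by (simp add: proj_mult[OF Q] is_horizontal_lift_def)
  ultimately show ?thesis
    unfolding is_horizontal_lift_def horizontal_space_def tangent_space_def using c' by blast
qed

text \<open>The lifts at \<open>G ** Q\<close> are \<open>v ** Q\<close> and \<open>w ** Q\<close>,
  with the same inner product. The value is thus common to all representatives, as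
  \<open>induced\<close> requires.\<close>

lemma quot_metric_eq:
  assumes G: "G \<in> orth_pow" and "is_horizontal_lift G \<xi> v" "is_horizontal_lift G \<eta> w"
  shows "quot_metric (proj G) \<xi> \<eta> = frob v w"
proof -
  have "horizontal_lift (G ** Q) \<xi> = v ** Q" "horizontal_lift (G ** Q) \<eta> = w ** Q"
    if "orthogonal_matrix Q" for Q
    using that assms by (auto intro!: horizontal_lift_eq is_horizontal_lift_mult orth_pow_mult)
  moreover have "horizontal_lift G \<xi> = v" "horizontal_lift G \<eta> = w"
    using assms horizontal_lift_eq by auto
  ultimately show ?thesis
    unfolding quot_metric_def by (subst induced_proj) (auto simp: frob_mult_orthogonal)
qed

section \<open>Gradients on the total space and on the quotient\<close>

lemma grad_eqI:
  assumes "g \<in> tangent_space orth_pow G"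
    and "\<And>v. v \<in> tangent_space orth_pow G \<Longrightarrow> frob g v = differential orth_pow F G v"
  shows "grad F G = g"
  unfolding grad_def
proof (rule the_equality)
  fix g' assume g': "g' \<in> tangent_space orth_pow G \<and>
    (\<forall>v\<in>tangent_space orth_pow G. frob g' v = differential orth_pow F G v)"
  \<comment> \<open>Both vectors represent the differential; testing with each of them makes
    \<open>g' - g\<close> orthogonal to itself.\<close>
  then have "frob g' g = frob g g" "frob g' g' = frob g g'" using assms by auto
  then have "(g' - g) \<bullet> (g' - g) = 0"
    unfolding frob_eq_inner by (simp add: inner_diff_left inner_diff_right inner_commute)
  then show "g' = g" by simp
qed (use assms in blast)

lemma is_horizontal_lift_quot_grad:
  assumes G: "G \<in> orth_pow" and f: "f \<in> quot_smooth"
    and g: "g \<in> tangent_space orth_pow G"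
      "\<And>v. v \<in> tangent_space orth_pow G \<Longrightarrow> frob g v = differential orth_pow (\<lambda>X. f (proj X)) G v"
  shows "is_horizontal_lift G (quot_grad f (proj G)) g"
proof -
  let ?T = "quot_tangent_space (proj G)"
  have "frob g w = 0" if w: "w \<in> vertical_space G" for w
  proof -
    obtain \<gamma> where c: "curve_in {X \<in> orth_pow. proj X = proj G} G w \<gamma>"
      using w unfolding vertical_space_def tangent_space_def by auto
    then have c': "curve_in orth_pow G w \<gamma>" by (rule curve_in_subset) auto
    have "((\<lambda>t. f (proj G)) has_vector_derivative differential orth_pow (\<lambda>X. f (proj X)) G w) (at 0)"
    proof (rule has_vector_derivative_eventually_eq)
      show "((\<lambda>t. f (proj (\<gamma> t))) has_vector_derivative differential orth_pow (\<lambda>X. f (proj X)) G w) (at 0)"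
        using dproj_along_curve[OF c' f] f
        by (simp add: dproj_def has_real_derivative_iff_has_vector_derivative)
      show "\<forall>\<^sub>F t in nhds 0. f (proj (\<gamma> t)) = f (proj G)"
        using curve_in_eventually[OF c] by eventually_elim simp
    qed
    then have "differential orth_pow (\<lambda>X. f (proj X)) G w = 0"
      using vector_derivative_unique_at has_vector_derivative_const by blast
    then show ?thesis using g(2)[of w] c' unfolding tangent_space_def by auto
  qed
  then have lift_g: "is_horizontal_lift G (dproj G g) g"
    using g(1) by (simp add: is_horizontal_lift_def horizontal_space_def)
  \<comment> \<open>By the definition of \<open>dproj\<close>, the differential of the pullback of
    \<open>f\<close> along a lift of \<open>\<eta>\<close> is \<open>\<eta> f\<close>, so
    \<open>g\<close> represents the differential downstairs too.\<close>
  have riesz: "frob g v = \<eta> f" if "is_horizontal_lift G \<eta> v" for \<eta> v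
    using that f g(2) by (auto simp: is_horizontal_lift_def horizontal_space_def dproj_def)
  have "quot_grad f (proj G) = dproj G g"
    unfolding quot_grad_def
  proof (rule the_equality, intro conjI ballI)
    show "dproj G g \<in> ?T" by (rule dproj_in_quot_tangent_space[OF g(1)])
    fix \<eta> assume "\<eta> \<in> ?T"
    then obtain v where "is_horizontal_lift G \<eta> v" using ex_horizontal_lift G by blast
    then show "quot_metric (proj G) (dproj G g) \<eta> = \<eta> f"
      using quot_metric_eq[OF G lift_g] riesz by simp
  next
    fix \<xi> assume \<xi>: "\<xi> \<in> ?T \<and> (\<forall>\<eta>\<in>?T. quot_metric (proj G) \<xi> \<eta> = \<eta> f)"
    then obtain u where u: "is_horizontal_lift G \<xi> u" using ex_horizontal_lift G by blast
    \<comment> \<open>Uniqueness is settled upstairs: the lift \<open>u\<close> of a second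
      candidate is tested against itself and against \<open>g\<close>, which forces
      \<open>u = g\<close>.\<close>
    have "frob u u = frob g u"
      using \<xi> quot_metric_eq[OF G u u] riesz[OF u] by simp
    moreover have "frob u g = frob g g"
      using \<xi> quot_metric_eq[OF G u lift_g] riesz[OF lift_g] dproj_in_quot_tangent_space[OF g(1)] by simp
    ultimately have "(u - g) \<bullet> (u - g) = 0"
      unfolding frob_eq_inner by (simp add: inner_diff_left inner_diff_right inner_commute)
    then show "\<xi> = dproj G g" using u by (simp add: is_horizontal_lift_def)
  qed
  then show ?thesis using lift_g by simp
qed


section \<open>The gradient of the cost function\<close>

lemma cost_mult:
  assumes "orthogonal_matrix Q" shows "cost C (X ** Q) = cost C X"
  using frob_mult_orthogonal[OF assms, of X "C ** X"]
  by (simp add: frob_def cost_def matrix_mul_assoc)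

lemma induced_cost: "induced (cost C) (proj X) = cost C X"
  by (rule induced_proj) (rule cost_mult)

lemma induced_cost_quot_smooth: "induced (cost C) \<in> quot_smooth"
proof -
  have "smooth_on UNIV (cost C)"
    unfolding cost_def[abs_def]
    by (intro smooth_on_bounded_linear[OF _ bounded_linear_trace] smooth_on_bilinear[OF bounded_bilinear_matrix_mult]
        smooth_on_bounded_linear[OF _ bounded_linear_transpose] smooth_on_ident smooth_on_const open_UNIV)
  then show ?thesis by (simp add: quot_smooth_def induced_cost smooth_fun_smooth_on)
qed

text \<open>The product rule yields two traces which are transposes of each other since
  \<open>C\<close> is symmetric; hence the factor 2.\<close>

lemma differential_cost:
  assumes C: "transpose C = C" and v: "v \<in> tangent_space orth_pow G"
  shows "differential orth_pow (cost C) G v = 2 * frob (C ** G) v"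
proof -
  obtain \<gamma> where c: "curve_in orth_pow G v \<gamma>" using v unfolding tangent_space_def by auto
  show ?thesis
  proof (rule differential_eqI[OF c])
    fix \<delta> assume "curve_in orth_pow G v \<delta>"
    then have d: "\<delta> 0 = G" "(\<delta> has_vector_derivative v) (at 0)" unfolding curve_in_def by auto
    have "((\<lambda>t. cost C (\<delta> t)) has_vector_derivative
        trace (transpose G ** C ** v + transpose v ** C ** G)) (at 0)"
      unfolding cost_def
      using bounded_linear.has_vector_derivative[OF bounded_linear_trace matrix_mult.has_vector_derivative[OF
          bounded_linear.has_vector_derivative[OF matrix_mult.bounded_linear_left
          bounded_linear.has_vector_derivative[OF bounded_linear_transpose d(2)]] d(2)]] d(1)
      by auto
    moreover have "trace (transpose v ** C ** G) = trace (transpose G ** C ** v)"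
      using trace_transpose[of "transpose v ** C ** G"] C by (simp add: matrix_transpose_mul matrix_mul_assoc)
    moreover have "frob (C ** G) v = trace (transpose G ** C ** v)"
      using C by (simp add: frob_def matrix_transpose_mul)
    ultimately show "((\<lambda>t. cost C (\<delta> t)) has_real_derivative 2 * frob (C ** G) v) (at 0)"
      by (simp add: has_real_derivative_iff_has_vector_derivative trace_add)
  qed
qed

text \<open>With \<open>P\<close> as below, block \<open>i\<close> times the transposed block of
  \<open>G\<close> is twice \<open>P\<close> minus its symmetric part, that is
  \<open>P - transpose P\<close>, which is skew.\<close>

lemma neg2_S_mat_tangent:
  fixes G :: "('n::finite, 'd::finite) stacked"
  assumes G: "G \<in> orth_pow"
  shows "(-2) *\<^sub>R (S_mat C G ** G) \<in> tangent_space orth_pow G"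
proof (rule tangent_spaceI[OF G])
  fix i
  define P where "P = row_block (C ** G) i ** transpose (row_block G i)"
  have "block (C ** G ** transpose G) i i = P" by (simp only: P_def block_mult_transpose)
  moreover have "(-2) *\<^sub>R (S_mat C G ** G) = 2 *\<^sub>R (C ** G - symblockdiag (C ** G ** transpose G) ** G)"
    by (simp add: S_mat_def matrix_mult.diff_left algebra_simps)
  moreover have "M ** row_block G i ** transpose (row_block G i) = M" for M :: "real^'d^'d"
    by (simp add: orth_pow_row_block[OF G] flip: matrix_mul_assoc)
  ultimately have "row_block ((-2) *\<^sub>R (S_mat C G ** G)) i ** transpose (row_block G i)
      = 2 *\<^sub>R (P - (1 / 2) *\<^sub>R (P + transpose P))"
    by (simp only: row_block_diff row_block_scaleR row_block_symblockdiag_mult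
        matrix_mult.diff_left matrix_mult.scaleR_left P_def)
  also have "\<dots> = P - transpose P" by (simp add: algebra_simps scaleR_2)
  finally show "transpose (row_block ((-2) *\<^sub>R (S_mat C G ** G)) i ** transpose (row_block G i))
      = - (row_block ((-2) *\<^sub>R (S_mat C G ** G)) i ** transpose (row_block G i))"
    by (simp add: transpose_diff)
qed

text \<open>The block diagonal term drops out: by cyclicity its pairing with \<open>v\<close> is a
  sum of traces of the symmetric \<open>D i\<close> times the skew
  \<open>row_block v i ** transpose (row_block G i)\<close>.\<close>

lemma frob_neg2_S_mat:
  fixes G :: "('n::finite, 'd::finite) stacked"
  assumes v: "v \<in> tangent_space orth_pow G"
  shows "frob ((-2) *\<^sub>R (S_mat C G ** G)) v = 2 * frob (C ** G) v"
proof -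
  define D where "D i = (1 / 2) *\<^sub>R (block (C ** G ** transpose G) i i + transpose (block (C ** G ** transpose G) i i))" for i
  have sym: "transpose (D i) = D i" for i
    by (simp add: D_def transpose_scalar transpose_add add.commute)
  have "trace (transpose (D i ** row_block G i) ** row_block v i) = 0" for i
  proof -
    have "trace (transpose (D i ** row_block G i) ** row_block v i)
        = trace (D i ** (row_block v i ** transpose (row_block G i)))"
      by (simp add: matrix_transpose_mul sym trace_mul_sym[of "transpose (row_block G i)"] flip: matrix_mul_assoc)
    then show ?thesis using trace_symmetric_mult_skew[OF sym tangent_space_skew(1)[OF v]] by simp
  qed
  then have "frob (symblockdiag (C ** G ** transpose G) ** G) v = 0"
    by (simp add: frob_def transpose_mult_row_blocks row_block_symblockdiag_mult
        linear_sum[OF bounded_linear.linear[OF bounded_linear_trace]] flip: D_def)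
  then show ?thesis
    by (simp add: S_mat_def matrix_mult.diff_left frob_eq_inner inner_diff_left)
qed

theorem lemma3p3:
  fixes C :: "('n::finite, 'd::finite) blockmat"
    and p :: "('n, 'd) cls"
    and G :: "('n, 'd) stacked"
  assumes "transpose C = C"
    and "p \<in> quot"
    and "G \<in> orth_pow" and "proj G = p"
  shows "(\<exists>!v. is_horizontal_lift G (quot_grad (induced (cost C)) p) v) \<and>
    horizontal_lift G (quot_grad (induced (cost C)) p) = grad (cost C) G \<and>
    grad (cost C) G = (-2) *\<^sub>R (S_mat C G ** G)"
proof -
  let ?g = "(-2) *\<^sub>R (S_mat C G ** G)"
  note g = neg2_S_mat_tangent[OF assms(3), of C]
  have d: "frob ?g v = differential orth_pow (cost C) G v" if "v \<in> tangent_space orth_pow G" for v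
    by (simp only: frob_neg2_S_mat[OF that] differential_cost[OF assms(1) that])
  \<comment> \<open>The pullback of \<open>induced (cost C)\<close> along \<open>proj\<close> is
    \<open>cost C\<close> itself, so the representation \<open>d\<close> supplies what is required
    of the differential on the quotient side.\<close>
  have "is_horizontal_lift G (quot_grad (induced (cost C)) (proj G)) ?g"
    by (rule is_horizontal_lift_quot_grad[OF assms(3) induced_cost_quot_smooth g])
       (simp only: induced_cost d)
  then have lift: "is_horizontal_lift G (quot_grad (induced (cost C)) p) ?g"
    by (simp only: assms(4))
  moreover have "grad (cost C) G = ?g" by (rule grad_eqI[OF g d])
  ultimately show ?thesis
    using horizontal_lift_unique[OF assms(3)] horizontal_lift_eq[OF assms(3) lift] by metis
qed

end
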